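(* Let $\Omega\subset\mathbb{C}^2$ be a smoothly bounded, pseudoconvex domain, $p_0\in b\Omega$. Then $\Omega$ admits a smooth local defining function near $p_0$ which is plurisubharmonic near $p_0$ if and only if there exist an open neighborhood $U$ of $p_0$ and a smooth local defining function $r$ for $\Omega$ on $U$ such that $$|H_r(L,N)|^2=\mathcal{O}(H_r(L,L))\ \text{ on } b\Omega\cap U,\quad\text{and}\quad |\nu H_r(L,L)|^2=\mathcal{O}(H_r(L,L))\ \text{ on } b\Omega\cap U.$$
   Context: "Smooth" means $\mathcal{C}^\infty$; "smoothly bounded" means that $b\Omega$ is smooth. A smooth function $r\colon U\to\mathbb{R}$ is a local defining function for $\Omega$ near $p_0\in b\Omega$ if $U$ is an open neighborhood of $p_0$, $\Omega\cap U=\{r<0\}$, and $dr\ne0$ on $b\Omega\cap U$. Coordinates are $(z,w)=(z^1,z^2)$. For $(1,0)$ vector fields, $H_f(A,B)=\sum_{j,k}\frac{\partial^2f}{\partial z^j\partial\bar z^k}A^j\overline{B^k}$. $\Omega$ is pseudoconvex if $H_r(A,A)\ge0$ on $b\Omega$ for every local defining function $r$ and every smooth $(1,0)$ vector field $A$ with $Ar=0$ on $b\Omega$. "Plurisubharmonic near $p_0$" means plurisubharmonic (complex Hessian positive semi-definite) on a full open neighborhood of $p_0$ in $\mathbb{C}^2$. Canonical vector fields of $r$, defined where $dr\ne0$ (in particular near $b\Omega\cap U$): $$L=L_r=\frac{1}{\sqrt{|r_z|^2+|r_w|^2}}\Big(r_w\frac{\partial}{\partial z}-r_z\frac{\partial}{\partial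 w}\Big),\qquad N=N_r=\frac{1}{\sqrt{|r_z|^2+|r_w|^2}}\Big(r_{\bar z}\frac{\partial}{\partial z}+r_{\bar w}\frac{\partial}{\partial w}\Big),$$ and $\nu=\operatorname{grad}r/|\operatorname{grad}r|$ (on $b\Omega$, the outward unit normal). $\nu H_r(L,L)$ is the derivative of the function $H_r(L,L)$ in direction $\nu$. (If the first condition holds, the second is unchanged when $L$ is replaced by any nonvanishing smooth $(1,0)$ vector field near $b\Omega\cap U$ that is tangential to $b\Omega$, i.e. annihilates $r$ on $b\Omega$.) For functions $f,g$ on $b\Omega\cap U$, "$f=\mathcal{O}(g)$ on $b\Omega\cap U$" means: for every $K\Subset b\Omega\cap U$ there is $C>0$ with $|f|\le C|g|$ on $K$. *)

theory Defs
  imports "HOL-Analysis.Analysis"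
begin

text \<open>
  Points of \<open>\<complex>\<^sup>2\<close> have type \<^typ>\<open>complex ^ 2\<close>, with coordinates \<open>z = p $ 1\<close> and \<open>w = p $ 2\<close>;
  the inner product and norm of this type are those of \<open>\<real>\<^sup>4\<close>. A \<open>(1,0)\<close> vector field
  \<open>A\<^sup>1 \<partial>/\<partial>z + A\<^sup>2 \<partial>/\<partial>w\<close> is represented by its coefficient map \<open>p \<mapsto> (A\<^sup>1 p, A\<^sup>2 p)\<close>.
  Functions on an open set \<open>U\<close> are total functions of which only the values on \<open>U\<close> are used.
\<close>

subsection \<open>Smoothness\<close>

text \<open>For open \<open>S\<close> this is the class \<open>C\<^sup>k\<close> in the real sense: the functions
  \<open>x \<mapsto> frechet_derivative f (at x) v\<close> are the directional derivatives of \<open>f\<close>.\<close>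

primrec Ck_on :: "nat \<Rightarrow> 'a::real_normed_vector set \<Rightarrow> ('a \<Rightarrow> 'b::real_normed_vector) \<Rightarrow> bool" where
  "Ck_on 0 S f \<longleftrightarrow> continuous_on S f"
| "Ck_on (Suc k) S f \<longleftrightarrow>
     (\<forall>x\<in>S. f differentiable (at x)) \<and> (\<forall>v. Ck_on k S (\<lambda>x. frechet_derivative f (at x) v))"

definition smooth_on :: "'a::real_normed_vector set \<Rightarrow> ('a \<Rightarrow> 'b::real_normed_vector) \<Rightarrow> bool" where
  "smooth_on S f \<longleftrightarrow> (\<forall>k. Ck_on k S f)"

subsection \<open>Wirtinger derivatives and the complex Hessian\<close>

definition wirtinger :: "2 \<Rightarrow> (complex ^ 2 \<Rightarrow> complex) \<Rightarrow> complex ^ 2 \<Rightarrow> complex" where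
  "wirtinger j f p =
     (frechet_derivative f (at p) (axis j 1) - \<i> * frechet_derivative f (at p) (axis j \<i>)) / 2"

definition wirtinger_bar :: "2 \<Rightarrow> (complex ^ 2 \<Rightarrow> complex) \<Rightarrow> complex ^ 2 \<Rightarrow> complex" where
  "wirtinger_bar j f p =
     (frechet_derivative f (at p) (axis j 1) + \<i> * frechet_derivative f (at p) (axis j \<i>)) / 2"

definition dz :: "2 \<Rightarrow> (complex ^ 2 \<Rightarrow> real) \<Rightarrow> complex ^ 2 \<Rightarrow> complex" where
  "dz j r = wirtinger j (\<lambda>p. complex_of_real (r p))"

definition dzbar :: "2 \<Rightarrow> (complex ^ 2 \<Rightarrow> real) \<Rightarrow> complex ^ 2 \<Rightarrow> complex" where
  "dzbar j r = wirtinger_bar j (\<lambda>p. complex_of_real (r p))"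

text \<open>The Hermitian form is taken at a point \<open>p\<close> on vectors \<open>a\<close>, \<open>b\<close>; for \<open>(1,0)\<close> fields
  \<open>A\<close>, \<open>B\<close> the function \<open>H\<^sub>r(A,B)\<close> is \<open>\<lambda>p. complex_hessian r p (A p) (B p)\<close>.
  For smooth \<open>r\<close> its values on the diagonal \<open>a = b\<close> are real.\<close>

definition complex_hessian ::
    "(complex ^ 2 \<Rightarrow> real) \<Rightarrow> complex ^ 2 \<Rightarrow> complex ^ 2 \<Rightarrow> complex ^ 2 \<Rightarrow> complex" where
  "complex_hessian r p a b =
     (\<Sum>j\<in>UNIV. \<Sum>k\<in>UNIV. wirtinger j (dzbar k r) p * (a $ j) * cnj (b $ k))"

definition psh_near :: "(complex ^ 2) set \<Rightarrow> (complex ^ 2 \<Rightarrow> real) \<Rightarrow> complex ^ 2 \<Rightarrow> bool" where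
  "psh_near U r p\<^sub>0 \<longleftrightarrow>
     (\<exists>V. open V \<and> p\<^sub>0 \<in> V \<and> V \<subseteq> U \<and> (\<forall>p\<in>V. \<forall>a. 0 \<le> Re (complex_hessian r p a a)))"

subsection \<open>Local defining functions and pseudoconvexity\<close>

text \<open>For open \<open>\<Omega>\<close>, \<open>r = 0\<close> on \<open>frontier \<Omega> \<inter> U\<close> follows by continuity.\<close>

definition local_defining_function ::
    "(complex ^ 2) set \<Rightarrow> complex ^ 2 \<Rightarrow> (complex ^ 2) set \<Rightarrow> (complex ^ 2 \<Rightarrow> real) \<Rightarrow> bool" where
  "local_defining_function \<Omega> p\<^sub>0 U r \<longleftrightarrow>
     p\<^sub>0 \<in> frontier \<Omega> \<and> open U \<and> p\<^sub>0 \<in> U \<and> smooth_on U r \<and>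
     \<Omega> \<inter> U = {p \<in> U. r p < 0} \<and>
     (\<forall>p \<in> frontier \<Omega> \<inter> U. \<exists>v. frechet_derivative r (at p) v \<noteq> 0)"

definition smooth_boundary :: "(complex ^ 2) set \<Rightarrow> bool" where
  "smooth_boundary \<Omega> \<longleftrightarrow> (\<forall>p \<in> frontier \<Omega>. \<exists>U r. local_defining_function \<Omega> p U r)"

definition pseudoconvex :: "(complex ^ 2) set \<Rightarrow> bool" where
  "pseudoconvex \<Omega> \<longleftrightarrow>
     (\<forall>p\<^sub>0 U r A.
        local_defining_function \<Omega> p\<^sub>0 U r \<and> smooth_on U A \<and>
        (\<forall>p \<in> frontier \<Omega> \<inter> U. (\<Sum>j\<in>UNIV. A p $ j * dz j r p) = 0) \<longrightarrow>
        (\<forall>p \<in> frontier \<Omega> \<inter> U. 0 \<le> Re (complex_hessian r p (A p) (A p))))"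

subsection \<open>Canonical vector fields\<close>

definition field_L :: "(complex ^ 2 \<Rightarrow> real) \<Rightarrow> complex ^ 2 \<Rightarrow> complex ^ 2" where
  "field_L r p =
     (1 / sqrt ((cmod (dz 1 r p))\<^sup>2 + (cmod (dz 2 r p))\<^sup>2)) *\<^sub>R vector [dz 2 r p, - dz 1 r p]"

definition field_N :: "(complex ^ 2 \<Rightarrow> real) \<Rightarrow> complex ^ 2 \<Rightarrow> complex ^ 2" where
  "field_N r p =
     (1 / sqrt ((cmod (dz 1 r p))\<^sup>2 + (cmod (dz 2 r p))\<^sup>2)) *\<^sub>R vector [dzbar 1 r p, dzbar 2 r p]"

definition gradient :: "(complex ^ 2 \<Rightarrow> real) \<Rightarrow> complex ^ 2 \<Rightarrow> complex ^ 2" where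
  "gradient r p = (THE g. GDERIV r p :> g)"

definition normal_field :: "(complex ^ 2 \<Rightarrow> real) \<Rightarrow> complex ^ 2 \<Rightarrow> complex ^ 2" where
  "normal_field r p = (1 / norm (gradient r p)) *\<^sub>R gradient r p"

definition hess_LL :: "(complex ^ 2 \<Rightarrow> real) \<Rightarrow> complex ^ 2 \<Rightarrow> complex" where
  "hess_LL r p = complex_hessian r p (field_L r p) (field_L r p)"

definition hess_LN :: "(complex ^ 2 \<Rightarrow> real) \<Rightarrow> complex ^ 2 \<Rightarrow> complex" where
  "hess_LN r p = complex_hessian r p (field_L r p) (field_N r p)"

definition normal_deriv_hess_LL :: "(complex ^ 2 \<Rightarrow> real) \<Rightarrow> complex ^ 2 \<Rightarrow> complex" where
  "normal_deriv_hess_LL r p = frechet_derivative (hess_LL r) (at p) (normal_field r p)"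

subsection \<open>Domination on relatively compact subsets\<close>

text \<open>Not the Landau symbol along a filter: the bound holds on all of \<open>K\<close>, for every \<open>K\<close> that is
  relatively compact in \<open>S\<close>, with a constant depending on \<open>K\<close>.\<close>

definition bigo_on ::
    "'a::topological_space set \<Rightarrow> ('a \<Rightarrow> 'b::real_normed_vector) \<Rightarrow> ('a \<Rightarrow> 'c::real_normed_vector) \<Rightarrow> bool"
  where
  "bigo_on S f g \<longleftrightarrow>
     (\<forall>K. compact (closure K) \<and> closure K \<subseteq> S \<longrightarrow> (\<exists>C>0. \<forall>p\<in>K. norm (f p) \<le> C * norm (g p)))"

end

theory Submission
  imports Defs
begin

text \<open>
  If \<open>r\<close> is plurisubharmonic near \<open>p\<^sub>0\<close>, the first estimate is the Cauchy-Schwarz inequality for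
  \<open>H\<^sub>r\<close>, and the second is Glaeser's inequality \<open>|\<nabla>f|\<^sup>2 \<le> C f\<close> for the nonnegative smooth
  function \<open>f = H\<^sub>r(L,L)\<close>.

  Conversely, let \<open>q\<close> be the boundary point nearest to \<open>p\<close> and \<open>t = |p - q|\<close>. As \<open>p - q\<close> is normal
  to the boundary, Taylor expansion at \<open>q\<close> gives \<open>f(p) \<ge> f(q) - C t \<surd>f(q) - C t\<^sup>2\<close>, and \<open>t\<close> is
  comparable to \<open>|r(p)|\<close>; hence \<open>|H\<^sub>r(L,N)|\<^sup>2 \<le> B (f + B r\<^sup>2)\<close> on a full neighborhood of \<open>p\<^sub>0\<close>. The
  function \<open>r + r\<^sup>2 (K + M |p - p\<^sub>0|\<^sup>2)\<close> is then plurisubharmonic near \<open>p\<^sub>0\<close>: because \<open>L r = 0\<close>, the new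
  term adds \<open>M r\<^sup>2\<close> to the Hessian in the direction \<open>L\<close>, which compensates the possible negativity
  of \<open>f\<close>, and \<open>2 K |N r|\<^sup>2\<close> in the direction \<open>N\<close>, which absorbs all mixed terms.
\<close>

subsection \<open>Functions of class \<open>C\<^sup>k\<close>\<close>

lemma frechet_derivative_eqI:
  "(f has_derivative f') (at x) \<Longrightarrow> frechet_derivative f (at x) = f'"
  using frechet_derivative_at by metis

lemma Ck_on_cong:
  assumes "open S" "\<And>x. x \<in> S \<Longrightarrow> f x = g x" "Ck_on k S f"
  shows "Ck_on k S g"
  using assms
proof (induction k arbitrary: f g)
  case 0
  then show ?case by (metis Ck_on.simps(1) continuous_on_cong)
next
  case (Suc k)
  have der: "(g has_derivative frechet_derivative f (at x)) (at x)" if "x \<in> S" for x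
    using Suc.prems that
    by (metis Ck_on.simps(2) frechet_derivative_works has_derivative_transform_within_open)
  have "Ck_on k S (\<lambda>x. frechet_derivative g (at x) v)" for v
  proof (rule Suc.IH)
    show "Ck_on k S (\<lambda>x. frechet_derivative f (at x) v)" using Suc.prems by simp
  qed (use Suc.prems(1) frechet_derivative_eqI[OF der] in auto)
  then show ?case using der by (auto simp: differentiable_def)
qed

text \<open>\<open>frechet_derivative\<close> is a choice term. Replacing it by an explicit
  derivative \<open>f'\<close> reduces each closure property below to a differentiation rule plus
  the induction hypothesis.\<close>

lemma Ck_on_SucI:
  assumes "open S" "\<And>x. x \<in> S \<Longrightarrow> (f has_derivative f' x) (at x)"
    and "\<And>v. Ck_on k S (\<lambda>x. f' x v)"
  shows "Ck_on (Suc k) S f"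
proof -
  have "Ck_on k S (\<lambda>x. frechet_derivative f (at x) v)" for v
    by (rule Ck_on_cong[OF assms(1) _ assms(3)[of v]])
      (simp add: frechet_derivative_eqI[OF assms(2)])
  then show ?thesis using assms(2) by (auto simp: differentiable_def)
qed

lemma Ck_on_subset: "Ck_on k S f \<Longrightarrow> T \<subseteq> S \<Longrightarrow> Ck_on k T f"
  by (induction k arbitrary: f) (auto intro: continuous_on_subset)

lemma Ck_on_SucD: "Ck_on (Suc k) S f \<Longrightarrow> Ck_on k S f"
proof (induction k arbitrary: f)
  case 0
  then show ?case
    by (auto intro!: differentiable_imp_continuous_on simp: differentiable_on_def
        differentiable_at_withinI)
next
  case (Suc k)
  then show ?case by (metis Ck_on.simps(2))
qed

lemma Ck_on_has_derivative:
  "Ck_on (Suc k) S f \<Longrightarrow> x \<in> S \<Longrightarrow> (f has_derivative frechet_derivative f (at x)) (at x)"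
  by (simp add: frechet_derivative_works)

lemma Ck_on_const: "Ck_on k S (\<lambda>x. c)"
proof (induction k arbitrary: c)
  case (Suc k)
  then show ?case by simp
qed simp

lemma Ck_on_bounded_linear:
  assumes "open S" "bounded_linear f"
  shows "Ck_on k S f"
proof (cases k)
  case 0
  then show ?thesis using assms by (simp add: linear_continuous_on)
next
  case (Suc n)
  then show ?thesis
    using Ck_on_SucI[OF assms(1) bounded_linear_imp_has_derivative[OF assms(2)] Ck_on_const]
    by simp
qed

lemma Ck_on_add:
  assumes "open S" "Ck_on k S f" "Ck_on k S g"
  shows "Ck_on k S (\<lambda>x. f x + g x)"
  using assms
proof (induction k arbitrary: f g)
  case (Suc k)
  show ?case
    by (rule Ck_on_SucI[where f' = "\<lambda>x v. frechet_derivative f (at x) v + frechet_derivative g (at x) v"])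
      (use Suc in \<open>auto intro!: has_derivative_add Ck_on_has_derivative\<close>)
qed (auto intro: continuous_on_add)

lemma Ck_on_bounded_linear_compose:
  assumes "open S" "bounded_linear h" "Ck_on k S f"
  shows "Ck_on k S (\<lambda>x. h (f x))"
  using assms(3)
proof (induction k arbitrary: f)
  case 0
  then show ?case using bounded_linear.continuous_on[OF assms(2)] by simp
next
  case (Suc k)
  show ?case
  proof (rule Ck_on_SucI[OF assms(1)])
    show "((\<lambda>x. h (f x)) has_derivative (\<lambda>v. h (frechet_derivative f (at x) v))) (at x)"
      if "x \<in> S" for x
      using bounded_linear.has_derivative[OF assms(2) Ck_on_has_derivative[OF Suc.prems that]] .
    show "Ck_on k S (\<lambda>x. h (frechet_derivative f (at x) v))" for v
      using Suc.prems by (intro Suc.IH) simp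
  qed
qed

lemma Ck_on_bounded_bilinear:
  assumes "bounded_bilinear B" "open S" "Ck_on k S f" "Ck_on k S g"
  shows "Ck_on k S (\<lambda>x. B (f x) (g x))"
  using assms(3,4)
proof (induction k arbitrary: f g)
  case 0
  then show ?case using bounded_bilinear.continuous_on[OF assms(1)] by simp
next
  case (Suc k)
  \<comment> \<open>The Leibniz rule leaves one factor undifferentiated, so the regularity of
    \<open>f\<close> and \<open>g\<close> themselves is lowered to \<open>k\<close> before the
    induction hypothesis is used.\<close>
  have fg: "Ck_on k S f" "Ck_on k S g"
    by (fact Ck_on_SucD[OF Suc.prems(1)], fact Ck_on_SucD[OF Suc.prems(2)])
  show ?case
  proof (rule Ck_on_SucI[OF assms(2)])
    show "((\<lambda>x. B (f x) (g x)) has_derivative (\<lambda>v. B (f x) (frechet_derivative g (at x) v)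
        + B (frechet_derivative f (at x) v) (g x))) (at x)" if "x \<in> S" for x
      using bounded_bilinear.FDERIV[OF assms(1) Ck_on_has_derivative[OF Suc.prems(1) that]
          Ck_on_has_derivative[OF Suc.prems(2) that]] .
    show "Ck_on k S (\<lambda>x. B (f x) (frechet_derivative g (at x) v)
        + B (frechet_derivative f (at x) v) (g x))" for v
      using Suc.prems by (intro Ck_on_add[OF assms(2)] Suc.IH fg) auto
  qed
qed

text \<open>The exponent stays arbitrary in the induction because differentiation lowers it by one.
  The case \<open>a = - (1/2)\<close> provides the normalising factor of the canonical
  frame.\<close>

lemma Ck_on_powr:
  fixes f :: "'a::real_normed_vector \<Rightarrow> real"
  assumes "open S" "Ck_on k S f" "\<And>x. x \<in> S \<Longrightarrow> 0 < f x"
  shows "Ck_on k S (\<lambda>x. f x powr a)"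
  using assms(2)
proof (induction k arbitrary: a)
  case 0
  then show ?case using assms(3) by (fastforce intro: continuous_on_powr continuous_on_const)
next
  case (Suc k)
  show ?case
  proof (rule Ck_on_SucI[OF assms(1)])
    show "((\<lambda>x. f x powr a) has_derivative
        (\<lambda>v. a * f x powr (a - 1) * frechet_derivative f (at x) v)) (at x)" if "x \<in> S" for x
      using has_derivative_powr[OF Ck_on_has_derivative[OF Suc.prems that] has_derivative_const, of a]
        assms(3)[OF that]
      by (simp add: powr_diff mult.commute mult.left_commute)
    show "Ck_on k S (\<lambda>x. a * f x powr (a - 1) * frechet_derivative f (at x) v)" for v
      using Suc.prems Ck_on_SucD[OF Suc.prems]
      by (intro Ck_on_bounded_bilinear[OF bounded_bilinear_mult assms(1)] Ck_on_const Suc.IH) simp_all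
  qed
qed

section \<open>Closure properties of smooth functions\<close>

lemma smooth_on_subset: "smooth_on S f \<Longrightarrow> T \<subseteq> S \<Longrightarrow> smooth_on T f"
  by (auto simp: smooth_on_def intro: Ck_on_subset)

lemma smooth_on_const: "smooth_on S (\<lambda>x. c)"
  by (simp add: smooth_on_def Ck_on_const)

lemma smooth_on_bounded_linear: "open S \<Longrightarrow> bounded_linear f \<Longrightarrow> smooth_on S f"
  by (simp add: smooth_on_def Ck_on_bounded_linear)

lemma smooth_on_cong: "open S \<Longrightarrow> (\<And>x. x \<in> S \<Longrightarrow> f x = g x) \<Longrightarrow> smooth_on S f \<Longrightarrow> smooth_on S g"
  unfolding smooth_on_def using Ck_on_cong by blast

lemma smooth_on_add:
  "open S \<Longrightarrow> smooth_on S f \<Longrightarrow> smooth_on S g \<Longrightarrow> smooth_on S (\<lambda>x. f x + g x)"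
  by (simp add: smooth_on_def Ck_on_add)

lemma smooth_on_bounded_linear_compose:
  "open S \<Longrightarrow> bounded_linear h \<Longrightarrow> smooth_on S f \<Longrightarrow> smooth_on S (\<lambda>x. h (f x))"
  by (simp add: smooth_on_def Ck_on_bounded_linear_compose)

lemma smooth_on_bounded_bilinear:
  "bounded_bilinear B \<Longrightarrow> open S \<Longrightarrow> smooth_on S f \<Longrightarrow> smooth_on S g
    \<Longrightarrow> smooth_on S (\<lambda>x. B (f x) (g x))"
  by (simp add: smooth_on_def Ck_on_bounded_bilinear)

lemmas smooth_on_scaleR = smooth_on_bounded_bilinear[OF bounded_bilinear_scaleR]
lemmas smooth_on_mult = smooth_on_bounded_bilinear[OF bounded_bilinear_mult]
lemmas smooth_on_inner = smooth_on_bounded_bilinear[OF bounded_bilinear_inner]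

lemma smooth_on_minus: "open S \<Longrightarrow> smooth_on S f \<Longrightarrow> smooth_on S (\<lambda>x. - f x)"
  by (rule smooth_on_bounded_linear_compose) (auto intro: bounded_linear_minus bounded_linear_ident)

lemma smooth_on_power2: "open S \<Longrightarrow> smooth_on S f \<Longrightarrow> smooth_on S (\<lambda>x. (f x)\<^sup>2 :: real)"
  unfolding power2_eq_square by (rule smooth_on_mult)

lemma smooth_on_powr:
  fixes f :: "'a::real_normed_vector \<Rightarrow> real"
  shows "open S \<Longrightarrow> smooth_on S f \<Longrightarrow> (\<And>x. x \<in> S \<Longrightarrow> 0 < f x) \<Longrightarrow> smooth_on S (\<lambda>x. f x powr a)"
  by (simp add: smooth_on_def Ck_on_powr)

lemma smooth_on_derivative:
  "smooth_on S f \<Longrightarrow> smooth_on S (\<lambda>x. frechet_derivative f (at x) v)"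
  unfolding smooth_on_def by (metis Ck_on.simps(2))

lemma smooth_on_has_derivative:
  "smooth_on S f \<Longrightarrow> x \<in> S \<Longrightarrow> (f has_derivative frechet_derivative f (at x)) (at x)"
  unfolding smooth_on_def using Ck_on_has_derivative by blast

lemma smooth_on_imp_continuous_on: "smooth_on S f \<Longrightarrow> continuous_on S f"
  unfolding smooth_on_def using Ck_on.simps(1) by blast

lemma has_real_derivative_along_line:
  fixes f :: "'a::real_normed_vector \<Rightarrow> real"
  assumes "(f has_derivative f') (at (c s))" "(c has_derivative (\<lambda>h. h *\<^sub>R u)) (at s)"
  shows "((\<lambda>s. f (c s)) has_real_derivative f' u) (at s)"
  using has_derivative_compose[OF assms(2,1)] linear_scale[OF has_derivative_linear[OF assms(1)]]
  by (simp add: has_field_derivative_def mult_commute_abs)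

subsection \<open>Second derivatives and Taylor's inequality\<close>

text \<open>The second difference over a parallelogram is the increment in direction
  \<open>u\<close> of a difference in direction \<open>v\<close>. The mean value theorem is applied
  first along \<open>u\<close>, then along \<open>v\<close>.\<close>

lemma second_derivative_mvt:
  fixes f :: "'a::real_normed_vector \<Rightarrow> real"
  assumes "smooth_on S f" "0 < t"
    and "\<And>a b. 0 \<le> a \<Longrightarrow> a \<le> t \<Longrightarrow> 0 \<le> b \<Longrightarrow> b \<le> t \<Longrightarrow> p + a *\<^sub>R u + b *\<^sub>R v \<in> S"
  obtains a b where "0 < a" "a < t" "0 < b" "b < t"
    "f (p + t *\<^sub>R u + t *\<^sub>R v) - f (p + t *\<^sub>R u) - f (p + t *\<^sub>R v) + f p
      = t\<^sup>2 * frechet_derivative (\<lambda>x. frechet_derivative f (at x) u) (at (p + a *\<^sub>R u + b *\<^sub>R v)) v"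
proof -
  let ?D = "\<lambda>x. frechet_derivative f (at x) u"
  \<comment> \<open>The vacuous \<open>0 *\<^sub>R v\<close> gives both summands the shape required
    by \<open>line\<close>, with \<open>b = t\<close> and \<open>b = 0\<close>.\<close>
  define g where "g s = f (p + s *\<^sub>R u + t *\<^sub>R v) - f (p + s *\<^sub>R u + 0 *\<^sub>R v)" for s
  have line: "((\<lambda>s. f (p + s *\<^sub>R u + b *\<^sub>R v)) has_real_derivative ?D (p + s *\<^sub>R u + b *\<^sub>R v)) (at s)"
    if "0 \<le> s" "s \<le> t" "0 \<le> b" "b \<le> t" for s b
    by (rule has_real_derivative_along_line[where c = "\<lambda>s. p + s *\<^sub>R u + b *\<^sub>R v"])
      (use assms that in \<open>auto intro!: smooth_on_has_derivative derivative_eq_intros\<close>)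
  have "(g has_real_derivative ?D (p + s *\<^sub>R u + t *\<^sub>R v) - ?D (p + s *\<^sub>R u + 0 *\<^sub>R v)) (at s)"
    if "0 \<le> s" "s \<le> t" for s
    unfolding g_def using that assms(2) by (intro DERIV_diff line) auto
  from MVT2[OF assms(2) this] obtain a where a: "0 < a" "a < t"
    and ga: "g t - g 0 = t * (?D (p + a *\<^sub>R u + t *\<^sub>R v) - ?D (p + a *\<^sub>R u + 0 *\<^sub>R v))" by auto
  have "((\<lambda>b. ?D (p + a *\<^sub>R u + b *\<^sub>R v)) has_real_derivative
      frechet_derivative ?D (at (p + a *\<^sub>R u + b *\<^sub>R v)) v) (at b)"
    if "0 \<le> b" "b \<le> t" for b
    by (rule has_real_derivative_along_line[where c = "\<lambda>b. p + a *\<^sub>R u + b *\<^sub>R v"])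
      (use assms a that in \<open>auto intro!: smooth_on_has_derivative smooth_on_derivative derivative_eq_intros\<close>)
  from MVT2[OF assms(2) this] obtain b where b: "0 < b" "b < t"
    and "?D (p + a *\<^sub>R u + t *\<^sub>R v) - ?D (p + a *\<^sub>R u + 0 *\<^sub>R v)
      = t * frechet_derivative ?D (at (p + a *\<^sub>R u + b *\<^sub>R v)) v" by auto
  with ga show ?thesis
    by (intro that[OF a b]) (simp add: g_def power2_eq_square algebra_simps)
qed

text \<open>Schwarz's theorem. The second difference is symmetric in \<open>u\<close> and
  \<open>v\<close>; divided by \<open>t\<^sup>2\<close> it is a value of either mixed derivative at
  a point near \<open>p\<close>, and both derivatives are continuous at \<open>p\<close>.\<close>

lemma smooth_on_second_derivative_commute:
  fixes f :: "'a::real_normed_vector \<Rightarrow> real"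
  assumes "smooth_on S f" "open S" "p \<in> S"
  shows "frechet_derivative (\<lambda>x. frechet_derivative f (at x) u) (at p) v
       = frechet_derivative (\<lambda>x. frechet_derivative f (at x) v) (at p) u"
proof -
  define F where "F u v x = frechet_derivative (\<lambda>x. frechet_derivative f (at x) u) (at x) v" for u v x
  have cont: "isCont (F u v) p" for u v
    unfolding F_def
    using smooth_on_imp_continuous_on[OF smooth_on_derivative[OF smooth_on_derivative[OF assms(1)]]]
      assms(2,3) continuous_on_eq_continuous_at by blast
  have "\<bar>F u v p - F v u p\<bar> \<le> e" if e: "e > 0" for e
  proof -
    obtain d1 where d1: "d1 > 0" "\<And>x. dist x p < d1 \<Longrightarrow> dist (F u v x) (F u v p) < e/2"
      using cont[of u v] half_gt_zero[OF e] unfolding continuous_at_eps_delta by blast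
    obtain d2 where d2: "d2 > 0" "\<And>x. dist x p < d2 \<Longrightarrow> dist (F v u x) (F v u p) < e/2"
      using cont[of v u] half_gt_zero[OF e] unfolding continuous_at_eps_delta by blast
    obtain d3 where d3: "d3 > 0" "ball p d3 \<subseteq> S"
      using assms(2,3) open_contains_ball by blast
    define d where "d = min d1 (min d2 d3)"
    \<comment> \<open>At this scale the whole parallelogram stays within \<open>d / 2\<close> of
      \<open>p\<close>; the summand 1 covers the case \<open>u = v = 0\<close>.\<close>
    define t where "t = d / 2 / (1 + norm u + norm v)"
    have uv: "0 < 1 + norm u + norm v" by (intro add_pos_nonneg) auto
    have dt: "d > 0" "t > 0" using d1(1) d2(1) d3(1) uv by (auto simp: d_def t_def)
    have close: "dist (p + a *\<^sub>R u + b *\<^sub>R v) p < d" if "0 \<le> a" "a \<le> t" "0 \<le> b" "b \<le> t" for a b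
    proof -
      have "norm (a *\<^sub>R u + b *\<^sub>R v) \<le> t * norm u + t * norm v"
        using that by (intro norm_triangle_le add_mono) (auto intro: mult_right_mono)
      also have "\<dots> \<le> t * (1 + norm u + norm v)" using dt by (simp add: algebra_simps)
      also have "\<dots> = d / 2"
        unfolding t_def by (rule nonzero_eq_divide_eq[THEN iffD1, OF _ refl]) (use uv in simp)
      finally show ?thesis using dt by (simp add: dist_norm add.assoc)
    qed
    have inS: "p + a *\<^sub>R u + b *\<^sub>R v \<in> S" if "0 \<le> a" "a \<le> t" "0 \<le> b" "b \<le> t" for a b
      using close[OF that] d3 by (auto simp: d_def dist_commute)
    obtain a b where ab: "0 < a" "a < t" "0 < b" "b < t"
      "f (p + t *\<^sub>R u + t *\<^sub>R v) - f (p + t *\<^sub>R u) - f (p + t *\<^sub>R v) + f p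
        = t\<^sup>2 * F u v (p + a *\<^sub>R u + b *\<^sub>R v)"
      unfolding F_def by (rule second_derivative_mvt[OF assms(1) dt(2) inS])
    have inS': "p + a *\<^sub>R v + b *\<^sub>R u \<in> S" if "0 \<le> a" "a \<le> t" "0 \<le> b" "b \<le> t" for a b
      using inS[of b a] that by (simp add: algebra_simps)
    obtain a' b' where ab': "0 < a'" "a' < t" "0 < b'" "b' < t"
      "f (p + t *\<^sub>R v + t *\<^sub>R u) - f (p + t *\<^sub>R v) - f (p + t *\<^sub>R u) + f p
        = t\<^sup>2 * F v u (p + a' *\<^sub>R v + b' *\<^sub>R u)"
      unfolding F_def by (rule second_derivative_mvt[OF assms(1) dt(2) inS'])
    have "t\<^sup>2 * F u v (p + a *\<^sub>R u + b *\<^sub>R v) = t\<^sup>2 * F v u (p + a' *\<^sub>R v + b' *\<^sub>R u)"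
      using ab(5) ab'(5) by (simp add: algebra_simps)
    then have "F u v (p + a *\<^sub>R u + b *\<^sub>R v) = F v u (p + b' *\<^sub>R u + a' *\<^sub>R v)"
      using dt by (simp add: algebra_simps)
    moreover have "dist (F u v (p + a *\<^sub>R u + b *\<^sub>R v)) (F u v p) < e/2"
      using close[of a b] ab by (intro d1) (auto simp: d_def)
    moreover have "dist (F v u (p + b' *\<^sub>R u + a' *\<^sub>R v)) (F v u p) < e/2"
      using close[of b' a'] ab' by (intro d2) (auto simp: d_def)
    ultimately show ?thesis unfolding dist_real_def by linarith
  qed
  then have "\<bar>F u v p - F v u p\<bar> \<le> 0"
    using field_le_epsilon[of "\<bar>F u v p - F v u p\<bar>" 0] by simp
  then show ?thesis by (simp add: F_def)
qed

text \<open>Each partial derivative is continuous, hence bounded on the compact ball. Expanding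
  \<open>v\<close> in the finite basis makes the bound uniform in the direction.\<close>

lemma smooth_on_derivative_bounded:
  fixes f :: "'a::euclidean_space \<Rightarrow> 'b::real_normed_vector"
  assumes "smooth_on S f" "cball p e \<subseteq> S"
  obtains C where "0 \<le> C"
    "\<And>x v. x \<in> cball p e \<Longrightarrow> norm (frechet_derivative f (at x) v) \<le> C * norm v"
proof -
  have "\<exists>C\<ge>0. \<forall>x\<in>cball p e. norm (frechet_derivative f (at x) b) \<le> C" for b
  proof -
    have "continuous_on (cball p e) (\<lambda>x. frechet_derivative f (at x) b)"
      by (rule continuous_on_subset[OF smooth_on_imp_continuous_on assms(2)])
        (rule smooth_on_derivative[OF assms(1)])
    then have "bounded ((\<lambda>x. frechet_derivative f (at x) b) ` cball p e)"
      by (intro compact_imp_bounded compact_continuous_image) auto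
    then show ?thesis
      unfolding bounded_pos by (auto intro: less_imp_le)
  qed
  then obtain C where C: "\<And>b. C b \<ge> 0"
    "\<And>b x. x \<in> cball p e \<Longrightarrow> norm (frechet_derivative f (at x) b) \<le> C b"
    by metis
  show thesis
  proof
    show "0 \<le> sum C Basis" using C by (intro sum_nonneg) auto
    show "norm (frechet_derivative f (at x) v) \<le> sum C Basis * norm v" if "x \<in> cball p e" for x v
    proof -
      have lin: "linear (frechet_derivative f (at x))"
        using smooth_on_has_derivative[OF assms(1)] assms(2) that has_derivative_linear by blast
      have "frechet_derivative f (at x) v = frechet_derivative f (at x) (\<Sum>b\<in>Basis. (v \<bullet> b) *\<^sub>R b)"
        by (simp add: euclidean_representation)
      also have "\<dots> = (\<Sum>b\<in>Basis. (v \<bullet> b) *\<^sub>R frechet_derivative f (at x) b)"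
        by (simp add: linear_sum[OF lin] linear_scale[OF lin])
      also have "norm \<dots> \<le> (\<Sum>b\<in>Basis. C b * norm v)"
        by (rule sum_norm_le)
          (use C that Basis_le_norm in \<open>auto simp: mult.commute[of "C _"] intro!: mult_mono\<close>)
      finally show ?thesis by (simp add: sum_distrib_right)
    qed
  qed
qed

lemma smooth_on_lipschitz:
  fixes f :: "'a::euclidean_space \<Rightarrow> 'b::real_normed_vector"
  assumes "smooth_on S f" "cball p e \<subseteq> S"
  obtains C where "0 \<le> C"
    "\<And>x y. x \<in> cball p e \<Longrightarrow> y \<in> cball p e \<Longrightarrow> norm (f y - f x) \<le> C * norm (y - x)"
proof -
  obtain C where C: "0 \<le> C"
    "\<And>x v. x \<in> cball p e \<Longrightarrow> norm (frechet_derivative f (at x) v) \<le> C * norm v"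
    using smooth_on_derivative_bounded[OF assms] by blast
  have "norm (f y - f x) \<le> C * norm (y - x)" if "x \<in> cball p e" "y \<in> cball p e" for x y
  proof (rule differentiable_bound[OF convex_cball])
    show "(f has_derivative frechet_derivative f (at x)) (at x within cball p e)"
      if "x \<in> cball p e" for x
      using smooth_on_has_derivative[OF assms(1)] assms(2) that has_derivative_at_withinI by blast
    show "onorm (frechet_derivative f (at x)) \<le> C" if "x \<in> cball p e" for x
      using C that by (intro onorm_le) auto
  qed (use that in auto)
  with C(1) that show thesis by blast
qed

text \<open>The partial derivatives are Lipschitz on the ball, so along the segment from
  \<open>x\<close> to \<open>y\<close> the derivative deviates from its value at \<open>x\<close> by
  a multiple of \<open>norm (y - x)\<close> in operator norm. The mean value inequality for
  \<open>f\<close> minus its linear part contributes the second factor.\<close>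

lemma smooth_on_taylor:
  fixes f :: "'a::euclidean_space \<Rightarrow> real"
  assumes "smooth_on S f" "cball p e \<subseteq> S"
  obtains C where "0 \<le> C"
    "\<And>x y. x \<in> cball p e \<Longrightarrow> y \<in> cball p e
      \<Longrightarrow> \<bar>f y - f x - frechet_derivative f (at x) (y - x)\<bar> \<le> C * (norm (y - x))\<^sup>2"
proof -
  let ?D = "\<lambda>x. frechet_derivative f (at x)"
  have "\<exists>C\<ge>0. \<forall>x\<in>cball p e. \<forall>y\<in>cball p e. norm (?D y b - ?D x b) \<le> C * norm (y - x)" for b
    using smooth_on_lipschitz[OF smooth_on_derivative[OF assms(1)] assms(2)] by metis
  then obtain C where C: "\<And>b. C b \<ge> 0"
    "\<And>b x y. x \<in> cball p e \<Longrightarrow> y \<in> cball p e \<Longrightarrow> norm (?D y b - ?D x b) \<le> C b * norm (y - x)"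
    by metis
  have der: "(f has_derivative ?D x) (at x)" if "x \<in> cball p e" for x
    using smooth_on_has_derivative[OF assms(1)] assms(2) that by blast
  have D: "norm (?D y v - ?D x v) \<le> sum C Basis * norm (y - x) * norm v"
    if "x \<in> cball p e" "y \<in> cball p e" for x y v
  proof -
    have lin: "linear (\<lambda>v. ?D y v - ?D x v)"
      using that by (intro linear_compose_sub) (auto intro: has_derivative_linear[OF der])
    have "?D y v - ?D x v = (\<lambda>v. ?D y v - ?D x v) (\<Sum>b\<in>Basis. (v \<bullet> b) *\<^sub>R b)"
      by (simp add: euclidean_representation)
    also have "\<dots> = (\<Sum>b\<in>Basis. (v \<bullet> b) *\<^sub>R (?D y b - ?D x b))"
      by (simp only: linear_sum[OF lin] linear_scale[OF lin])
    also have "norm \<dots> \<le> (\<Sum>b\<in>Basis. norm v * (C b * norm (y - x)))"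
    proof (rule sum_norm_le)
      fix b :: 'a assume "b \<in> Basis"
      then show "norm ((v \<bullet> b) *\<^sub>R (?D y b - ?D x b)) \<le> norm v * (C b * norm (y - x))"
        unfolding norm_scaleR using C that by (intro mult_mono) (auto simp: Basis_le_norm)
    qed
    also have "\<dots> = sum C Basis * norm (y - x) * norm v"
      by (simp add: sum_distrib_left sum_distrib_right mult_ac)
    finally show ?thesis .
  qed
  have C0: "0 \<le> sum C Basis" using C by (intro sum_nonneg) auto
  have "\<bar>f y - f x - ?D x (y - x)\<bar> \<le> sum C Basis * (norm (y - x))\<^sup>2"
    if xy: "x \<in> cball p e" "y \<in> cball p e" for x y
  proof -
    have "norm (f y - f x - ?D x (y - x)) \<le> norm (y - x) * (sum C Basis * norm (y - x))"
    proof (rule differentiable_bound_linearization[where S = "closed_segment x y"])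
      show "x + t *\<^sub>R (y - x) \<in> closed_segment x y" if "t \<in> {0..1}" for t
        using that by (auto simp: in_segment algebra_simps intro!: exI[of _ t])
      fix \<xi> assume \<xi>: "\<xi> \<in> closed_segment x y"
      then have \<xi>': "\<xi> \<in> cball p e"
        using xy closed_segment_subset convex_cball by blast
      then show "(f has_derivative ?D \<xi>) (at \<xi> within closed_segment x y)"
        using der has_derivative_at_withinI by blast
      have "norm (\<xi> - x) \<le> norm (y - x)"
        using segment_bound(1)[OF \<xi>] .
      then have "norm (?D \<xi> v - ?D x v) \<le> sum C Basis * norm (y - x) * norm v" for v
        using D[OF xy(1) \<xi>', of v] C0
        by (meson mult_left_mono mult_right_mono norm_ge_zero order_trans)
      then show "onorm (?D \<xi> - ?D x) \<le> sum C Basis * norm (y - x)"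
        by (intro onorm_le) simp
    qed auto
    then show ?thesis by (simp add: power2_eq_square mult_ac)
  qed
  with C0 that show thesis by blast
qed

text \<open>Taylor's inequality at \<open>x + s v\<close>, with \<open>s\<close> a small multiple of the derivative in direction \<open>v\<close>.\<close>
lemma smooth_on_glaeser:
  fixes f :: "'a::euclidean_space \<Rightarrow> real"
  assumes "smooth_on S f" "cball p e \<subseteq> S" "0 < e" "\<And>x. x \<in> cball p e \<Longrightarrow> 0 \<le> f x"
  obtains C where "0 < C" "\<And>x v. x \<in> cball p (e/2) \<Longrightarrow> norm v \<le> 1
    \<Longrightarrow> (frechet_derivative f (at x) v)\<^sup>2 \<le> C * f x"
proof -
  obtain C where C: "0 \<le> C" "\<And>x y. x \<in> cball p e \<Longrightarrow> y \<in> cball p e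
      \<Longrightarrow> \<bar>f y - f x - frechet_derivative f (at x) (y - x)\<bar> \<le> C * (norm (y - x))\<^sup>2"
    using smooth_on_taylor[OF assms(1,2)] by blast
  obtain B where B: "0 \<le> B"
    "\<And>x v. x \<in> cball p e \<Longrightarrow> norm (frechet_derivative f (at x) v) \<le> B * norm v"
    using smooth_on_derivative_bounded[OF assms(1,2)] by blast
  \<comment> \<open>\<open>E\<close> dominates the Taylor constant \<open>C\<close>, and
    \<open>B \<le> E * e\<close> limits the step \<open>s\<close> below to \<open>e / 2\<close>, so
    that the test point stays in the larger ball. The summand 1 makes \<open>E\<close>
    positive.\<close>
  define E where "E = C + B / e + 1"
  have "0 \<le> B / e" using B(1) assms(3) by simp
  then have E: "E > 0" "C \<le> E" using C(1) by (auto simp: E_def)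
  have "E * e = C * e + B + e" using assms(3) by (simp add: E_def field_simps)
  then have "B \<le> E * e" using C(1) assms(3) by simp
  note E = E this
  have "(frechet_derivative f (at x) v)\<^sup>2 \<le> 4 * E * f x" if x: "x \<in> cball p (e/2)" and v: "norm v \<le> 1" for x v
  proof -
    define D where "D = frechet_derivative f (at x) v"
    \<comment> \<open>The minimiser of the quadratic \<open>f x + s * D + E * s\<^sup>2\<close>,
      whose minimum is \<open>f x - D\<^sup>2 / (4 * E)\<close>.\<close>
    define s where "s = - D / (2 * E)"
    have xe: "x \<in> cball p e" using x assms(3) by auto
    have "\<bar>D\<bar> \<le> B" using B(2)[OF xe, of v] mult_left_mono[OF v B(1)] by (simp add: D_def)
    then have "\<bar>s\<bar> \<le> e / 2" using E by (simp add: s_def field_simps abs_mult)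
    then have sv: "norm (s *\<^sub>R v) \<le> e / 2" "(norm (s *\<^sub>R v))\<^sup>2 \<le> s\<^sup>2"
      using v mult_mono[of "\<bar>s\<bar>" "e/2" "norm v" 1] assms(3)
      by (auto simp: power_mult_distrib power_le_one mult_left_le)
    have y: "x + s *\<^sub>R v \<in> cball p e"
      using x sv(1) norm_triangle_ineq[of "x - p" "s *\<^sub>R v"] by (auto simp: dist_norm norm_minus_commute algebra_simps)
    have "linear (frechet_derivative f (at x))"
      using smooth_on_has_derivative[OF assms(1)] assms(2) xe has_derivative_linear by blast
    then have "frechet_derivative f (at x) (s *\<^sub>R v) = s * D" by (simp add: linear_scale D_def)
    then have "f (x + s *\<^sub>R v) \<le> f x + s * D + C * (norm (s *\<^sub>R v))\<^sup>2"
      using C(2)[OF xe y] by simp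
    also have "C * (norm (s *\<^sub>R v))\<^sup>2 \<le> E * s\<^sup>2"
      using sv(2) E C(1) by (intro mult_mono) auto
    finally have "0 \<le> f x + s * D + E * s\<^sup>2" using assms(4)[OF y] by simp
    also have "\<dots> = f x - D\<^sup>2 / (4 * E)"
      using E by (simp add: s_def field_simps power2_eq_square)
    finally show ?thesis using E by (simp add: D_def field_simps)
  qed
  then show thesis using E that[of "4 * E"] by simp
qed

text \<open>By compactness finitely many of the local balls cover \<open>closure K\<close>. The sum
  of the absolute values of their constants serves for all of them; adding 1 makes it
  positive.\<close>

lemma bigo_on_local:
  fixes f :: "'a::metric_space \<Rightarrow> 'b::real_normed_vector" and g :: "'a \<Rightarrow> 'c::real_normed_vector"
  assumes "\<And>p. p \<in> S \<Longrightarrow> \<exists>e>0. \<exists>C. \<forall>x\<in>ball p e. norm (f x) \<le> C * norm (g x)"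
  shows "bigo_on S f g"
  unfolding bigo_on_def
proof (intro allI impI, elim conjE)
  fix K assume K: "compact (closure K)" "closure K \<subseteq> S"
  obtain e C where eC: "\<And>p. p \<in> S \<Longrightarrow> e p > 0"
    "\<And>p x. p \<in> S \<Longrightarrow> x \<in> ball p (e p) \<Longrightarrow> norm (f x) \<le> C p * norm (g x)"
    using assms by metis
  have "closure K \<subseteq> (\<Union>p\<in>closure K. ball p (e p))"
    using K(2) eC(1) by fastforce
  from compactE_image[OF K(1) _ this] obtain T where T: "T \<subseteq> closure K" "finite T"
    "closure K \<subseteq> (\<Union>p\<in>T. ball p (e p))" by auto
  have "norm (f x) \<le> (1 + (\<Sum>p\<in>T. \<bar>C p\<bar>)) * norm (g x)" if x: "x \<in> K" for x
  proof -
    obtain p where p: "p \<in> T" "x \<in> ball p (e p)" using T(3) closure_subset[THEN subsetD, OF x] by blast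
    then have "norm (f x) \<le> C p * norm (g x)" by (intro eC(2)) (use T(1) K(2) in auto)
    also have "\<bar>C p\<bar> \<le> (\<Sum>p\<in>T. \<bar>C p\<bar>)"
      using p T(2) by (intro member_le_sum) auto
    then have "C p * norm (g x) \<le> (1 + (\<Sum>p\<in>T. \<bar>C p\<bar>)) * norm (g x)"
      by (intro mult_right_mono) auto
    finally show ?thesis .
  qed
  then show "\<exists>C>0. \<forall>p\<in>K. norm (f p) \<le> C * norm (g p)"
    by (intro exI[of _ "1 + (\<Sum>p\<in>T. \<bar>C p\<bar>)"]) (auto intro!: add_pos_nonneg sum_nonneg)
qed

subsection \<open>Wirtinger calculus and the complex Hessian\<close>

lemma wirtinger_eq:
  "(f has_derivative f') (at p) \<Longrightarrow> wirtinger j f p = (f' (axis j 1) - \<i> * f' (axis j \<i>)) / 2"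
  by (simp add: wirtinger_def frechet_derivative_eqI)

lemma wirtinger_bar_eq:
  "(f has_derivative f') (at p) \<Longrightarrow> wirtinger_bar j f p = (f' (axis j 1) + \<i> * f' (axis j \<i>)) / 2"
  by (simp add: wirtinger_bar_def frechet_derivative_eqI)

lemma dz_eq:
  "(r has_derivative r') (at p) \<Longrightarrow> dz j r p = (of_real (r' (axis j 1)) - \<i> * of_real (r' (axis j \<i>))) / 2"
  unfolding dz_def by (rule wirtinger_eq) (auto intro: derivative_intros)

lemma dzbar_eq:
  "(r has_derivative r') (at p) \<Longrightarrow> dzbar j r p = (of_real (r' (axis j 1)) + \<i> * of_real (r' (axis j \<i>))) / 2"
  unfolding dzbar_def by (rule wirtinger_bar_eq) (auto intro: derivative_intros)

lemma dzbar_eq_cnj_dz: "(r has_derivative r') (at p) \<Longrightarrow> dzbar j r p = cnj (dz j r p)"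
  by (simp add: dz_eq dzbar_eq)

lemma wirtinger_cong:
  assumes "f differentiable (at p)" "open S" "p \<in> S" "\<And>x. x \<in> S \<Longrightarrow> f x = g x"
  shows "wirtinger j g p = wirtinger j f p"
proof -
  have "frechet_derivative f (at p) = frechet_derivative g (at p)"
    by (rule frechet_derivative_transform_within_open[OF assms])
  then show ?thesis by (simp add: wirtinger_def)
qed

lemma wirtinger_add:
  assumes "f differentiable (at p)" "g differentiable (at p)"
  shows "wirtinger j (\<lambda>x. f x + g x) p = wirtinger j f p + wirtinger j g p"
  by (simp add: wirtinger_eq[OF has_derivative_add[OF assms[unfolded frechet_derivative_works]]]
      wirtinger_def[of j f] wirtinger_def[of j g] field_simps)

lemma wirtinger_mult:
  assumes "f differentiable (at p)" "g differentiable (at p)"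
  shows "wirtinger j (\<lambda>x. f x * g x) p = wirtinger j f p * g p + f p * wirtinger j g p"
  by (simp add: wirtinger_eq[OF has_derivative_mult[OF assms[unfolded frechet_derivative_works]]]
      wirtinger_def[of j f] wirtinger_def[of j g] field_simps)

lemma wirtinger_const: "wirtinger j (\<lambda>x. c) p = 0"
  by (simp add: wirtinger_def)

section \<open>Smoothness of Wirtinger derivatives and of the Hessian\<close>

lemma smooth_on_of_real: "open S \<Longrightarrow> smooth_on S f \<Longrightarrow> smooth_on S (\<lambda>x. complex_of_real (f x))"
  by (rule smooth_on_bounded_linear_compose[OF _ bounded_linear_of_real])

lemma smooth_on_cnj: "open S \<Longrightarrow> smooth_on S f \<Longrightarrow> smooth_on S (\<lambda>x. cnj (f x))"
  by (rule smooth_on_bounded_linear_compose[OF _ bounded_linear_cnj])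

lemma smooth_on_cmult: "open S \<Longrightarrow> smooth_on S f \<Longrightarrow> smooth_on S (\<lambda>x. c * f x :: complex)"
  by (rule smooth_on_bounded_linear_compose[OF _ bounded_linear_mult_right])

lemma smooth_on_vec_nth: "open S \<Longrightarrow> smooth_on S f \<Longrightarrow> smooth_on S (\<lambda>x. f x $ j)"
  by (rule smooth_on_bounded_linear_compose[OF _ bounded_linear_vec_nth])

lemma smooth_on_wirtinger:
  assumes "open S" "smooth_on S f"
  shows "smooth_on S (wirtinger j f)"
proof -
  have "smooth_on S (\<lambda>p. (1/2) * (frechet_derivative f (at p) (axis j 1)
      + (- \<i>) * frechet_derivative f (at p) (axis j \<i>)))"
    using assms by (intro smooth_on_cmult smooth_on_add smooth_on_derivative)
  then show ?thesis by (rule smooth_on_cong[OF assms(1), rotated]) (simp add: wirtinger_def)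
qed

lemma smooth_on_wirtinger_bar:
  assumes "open S" "smooth_on S f"
  shows "smooth_on S (wirtinger_bar j f)"
proof -
  have "smooth_on S (\<lambda>p. (1/2) * (frechet_derivative f (at p) (axis j 1)
      + \<i> * frechet_derivative f (at p) (axis j \<i>)))"
    using assms by (intro smooth_on_cmult smooth_on_add smooth_on_derivative)
  then show ?thesis by (rule smooth_on_cong[OF assms(1), rotated]) (simp add: wirtinger_bar_def)
qed

lemma smooth_on_dz: "open S \<Longrightarrow> smooth_on S r \<Longrightarrow> smooth_on S (dz j r)"
  unfolding dz_def by (intro smooth_on_wirtinger smooth_on_of_real)

lemma smooth_on_dzbar: "open S \<Longrightarrow> smooth_on S r \<Longrightarrow> smooth_on S (dzbar j r)"
  unfolding dzbar_def by (intro smooth_on_wirtinger_bar smooth_on_of_real)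

lemma smooth_on_complex_hessian:
  assumes "open S" "smooth_on S r" "smooth_on S A" "smooth_on S B"
  shows "smooth_on S (\<lambda>p. complex_hessian r p (A p) (B p))"
  unfolding complex_hessian_def sum_2 using assms
  by (intro smooth_on_add smooth_on_mult smooth_on_wirtinger smooth_on_dzbar smooth_on_cnj
      smooth_on_vec_nth)

lemma smooth_on_differentiable: "smooth_on S f \<Longrightarrow> x \<in> S \<Longrightarrow> f differentiable (at x)"
  unfolding differentiable_def using smooth_on_has_derivative by blast

text \<open>Written out in real second derivatives of \<open>r\<close>, as in \<open>W\<close>, the
  two sides agree because these derivatives commute.\<close>

lemma complex_hessian_coeff_cnj:
  assumes "open S" "smooth_on S r" "p \<in> S"
  shows "wirtinger k (dzbar j r) p = cnj (wirtinger j (dzbar k r) p)"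
proof -
  define F where "F u v = frechet_derivative (\<lambda>x. frechet_derivative r (at x) u) (at p) v" for u v
  have F: "((\<lambda>x. frechet_derivative r (at x) u) has_derivative F u) (at p)" for u
    using smooth_on_has_derivative[OF smooth_on_derivative[OF assms(2)] assms(3)]
    by (simp add: F_def[abs_def])
  have sym: "F u v = F v u" for u v
    unfolding F_def by (rule smooth_on_second_derivative_commute[OF assms(2,1,3)])
  let ?g = "\<lambda>k x. (of_real (frechet_derivative r (at x) (axis k 1))
      + \<i> * of_real (frechet_derivative r (at x) (axis k \<i>))) / 2 :: complex"
  have der: "(?g k has_derivative (\<lambda>v. (of_real (F (axis k 1) v) + \<i> * of_real (F (axis k \<i>) v)) / 2)) (at p)" for k
    by (auto intro!: derivative_eq_intros F)
  have "wirtinger j (dzbar k r) p = wirtinger j (?g k) p" for j k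
    using der[of k] assms(1,3) by (intro wirtinger_cong[where S = S])
      (auto simp: differentiable_def dzbar_eq[OF smooth_on_has_derivative[OF assms(2)]])
  then have W: "wirtinger j (dzbar k r) p =
     ((of_real (F (axis k 1) (axis j 1)) + \<i> * of_real (F (axis k \<i>) (axis j 1))) / 2
     - \<i> * ((of_real (F (axis k 1) (axis j \<i>)) + \<i> * of_real (F (axis k \<i>) (axis j \<i>))) / 2)) / 2"
    for j k by (simp only: wirtinger_eq[OF der])
  show ?thesis
    unfolding W[of k j] W[of j k]
    by (simp add: complex_eq_iff sym[of "axis k 1" "axis j _"] sym[of "axis k \<i>" "axis j _"])
qed

section \<open>The Hessian as a Hermitian form\<close>

lemma complex_hessian_cnj:
  assumes "open S" "smooth_on S r" "p \<in> S"
  shows "complex_hessian r p b a = cnj (complex_hessian r p a b)"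
  unfolding complex_hessian_def sum_2
  using complex_hessian_coeff_cnj[OF assms, of 1 1] complex_hessian_coeff_cnj[OF assms, of 2 2]
    complex_hessian_coeff_cnj[OF assms, of 1 2]
  by (simp add: algebra_simps)

lemma complex_hessian_real:
  assumes "open S" "smooth_on S r" "p \<in> S"
  shows "complex_hessian r p a a = of_real (Re (complex_hessian r p a a))"
  using complex_hessian_cnj[OF assms, of a a] by (simp add: complex_eq_iff)

lemma complex_hessian_combination:
  assumes "open S" "smooth_on S r" "p \<in> S"
  shows "Re (complex_hessian r p (x *s a + y *s b) (x *s a + y *s b)) =
    (cmod x)\<^sup>2 * Re (complex_hessian r p a a) + 2 * Re (x * cnj y * complex_hessian r p a b)
    + (cmod y)\<^sup>2 * Re (complex_hessian r p b b)"
proof -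
  let ?H = "complex_hessian r p"
  have "?H (x *s a + y *s b) (x *s a + y *s b) =
     (x * cnj x) * ?H a a + x * cnj y * ?H a b + cnj x * y * ?H b a + (y * cnj y) * ?H b b"
    by (simp add: complex_hessian_def sum_2 algebra_simps)
  also have "cnj x * y * ?H b a = cnj (x * cnj y * ?H a b)"
    using complex_hessian_cnj[OF assms, of b a] by simp
  finally show ?thesis
    by (simp add: complex_norm_square[symmetric] del: complex_mult_cnj complex_cnj_mult)
qed

lemma complex_hessian_cauchy_schwarz:
  assumes "open S" "smooth_on S r" "p \<in> S" "\<And>a. 0 \<le> Re (complex_hessian r p a a)"
  shows "(cmod (complex_hessian r p a b))\<^sup>2
     \<le> Re (complex_hessian r p a a) * Re (complex_hessian r p b b)"
proof -
  define h where "h = complex_hessian r p a b"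
  define A where "A = Re (complex_hessian r p a a)"
  define B where "B = Re (complex_hessian r p b b)"
  have pos: "0 \<le> A" "0 \<le> B" using assms(4) by (auto simp: A_def B_def)
  \<comment> \<open>The form is tested on \<open>of_real t *s a + h *s b\<close>. The coefficient
    \<open>h\<close> absorbs the phase of the mixed term, which leaves a real quadratic in
    \<open>t\<close>.\<close>
  have quad: "0 \<le> t\<^sup>2 * A + 2 * t * (cmod h)\<^sup>2 + (cmod h)\<^sup>2 * B" for t
  proof -
    have "0 \<le> (cmod (of_real t))\<^sup>2 * A + 2 * Re (of_real t * cnj h * h) + (cmod h)\<^sup>2 * B"
      using assms(4)[of "of_real t *s a + h *s b"]
      unfolding complex_hessian_combination[OF assms(1-3)] A_def B_def h_def .
    also have "of_real t * cnj h * h = of_real (t * (cmod h)\<^sup>2)"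
      by (simp only: of_real_mult complex_norm_square mult_ac)
    finally show ?thesis by (simp add: mult.assoc)
  qed
  show ?thesis
  proof (cases "h = 0")
    case True
    then show ?thesis using pos by (simp add: h_def A_def B_def)
  next
    case False
    then have h: "(cmod h)\<^sup>2 > 0" by simp
    show ?thesis
    proof (cases "A = 0")
      case True
      \<comment> \<open>For \<open>A = 0\<close> the quadratic is linear in \<open>t\<close>, and
        this \<open>t\<close> makes it negative, which is absurd. In the other case below,
        \<open>t\<close> is the minimiser of the quadratic.\<close>
      have "0 \<le> (cmod h)\<^sup>2 * (- 2 * (B + 1) + B)"
        using quad[of "- (B + 1)"] True by (simp add: algebra_simps)
      then show ?thesis using h pos by (auto simp: zero_le_mult_iff)
    next
      case False
      then have "A > 0" using pos by simp
      then have "0 \<le> (cmod h)\<^sup>2 * (B - (cmod h)\<^sup>2 / A)"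
        using quad[of "- (cmod h)\<^sup>2 / A"] by (simp add: field_simps power2_eq_square)
      then have "(cmod h)\<^sup>2 / A \<le> B" using h by (simp add: zero_le_mult_iff)
      then show ?thesis using \<open>A > 0\<close> by (simp add: field_simps A_def B_def h_def)
    qed
  qed
qed

text \<open>Where \<open>dr\<close> does not vanish the canonical fields form a unitary basis, and
  \<open>x\<close>, \<open>y\<close> are the Hermitian products of \<open>a\<close> with them. Since
  \<open>L r = 0\<close>, the derivative of \<open>r\<close> along \<open>a\<close> sees only
  \<open>y\<close>.\<close>

lemma frame_decomposition:
  assumes "(r has_derivative r') (at p)" "0 < (cmod (dz 1 r p))\<^sup>2 + (cmod (dz 2 r p))\<^sup>2"
  obtains x y where "a = x *s field_L r p + y *s field_N r p"
    "(cmod x)\<^sup>2 + (cmod y)\<^sup>2 = (norm a)\<^sup>2"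
    "dz 1 r p * a $ 1 + dz 2 r p * a $ 2
      = y * of_real (sqrt ((cmod (dz 1 r p))\<^sup>2 + (cmod (dz 2 r p))\<^sup>2))"
proof -
  define u v where "u = dz 1 r p" and "v = dz 2 r p"
  define s where "s = sqrt ((cmod u)\<^sup>2 + (cmod v)\<^sup>2)"
  have s: "s > 0" "s\<^sup>2 = (cmod u)\<^sup>2 + (cmod v)\<^sup>2" using assms(2) by (auto simp: s_def u_def v_def)
  then have s2: "complex_of_real s * of_real s = u * cnj u + v * cnj v"
    by (metis complex_norm_square of_real_add of_real_mult power2_eq_square)
  have L: "field_L r p = (1 / s) *\<^sub>R vector [v, - u]"
    by (simp add: field_L_def s_def u_def v_def)
  have N: "field_N r p = (1 / s) *\<^sub>R vector [cnj u, cnj v]"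
    by (simp add: field_N_def s_def u_def v_def dzbar_eq_cnj_dz[OF assms(1)])
  define x where "x = (a $ 1 * cnj v - a $ 2 * cnj u) / of_real s"
  define y where "y = (a $ 1 * u + a $ 2 * v) / of_real s"
  have xs: "x * of_real s = a $ 1 * cnj v - a $ 2 * cnj u" and ys: "y * of_real s = a $ 1 * u + a $ 2 * v"
    using s by (simp_all add: x_def y_def)
  have cs: "complex_of_real s \<noteq> 0" using s by simp
  \<comment> \<open>This identity and the two coordinate identities below are checked after
    multiplication by \<open>of_real s * of_real s\<close>, which \<open>s2\<close> rewrites in
    terms of \<open>u\<close> and \<open>v\<close>.\<close>
  have nm: "x * cnj x + y * cnj y = a $ 1 * cnj (a $ 1) + a $ 2 * cnj (a $ 2)"
  proof -
    have "(x * cnj x + y * cnj y) * (of_real s * of_real s)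
       = (x * of_real s) * cnj (x * of_real s) + (y * of_real s) * cnj (y * of_real s)"
      by (simp add: algebra_simps)
    also have "\<dots> = (a $ 1 * cnj (a $ 1) + a $ 2 * cnj (a $ 2)) * (u * cnj u + v * cnj v)"
      unfolding xs ys by (simp add: algebra_simps)
    finally show ?thesis using cs unfolding s2[symmetric] by simp
  qed
  show thesis
  proof
    have "(x *s field_L r p + y *s field_N r p) $ 1 = a $ 1"
    proof -
      have "(x * (v / of_real s) + y * (cnj u / of_real s)) * (of_real s * of_real s)
         = (x * of_real s) * v + (y * of_real s) * cnj u"
        using cs by (simp add: field_simps)
      also have "\<dots> = a $ 1 * (u * cnj u + v * cnj v)"
        unfolding xs ys by (simp add: algebra_simps)
      finally have "x * (v / of_real s) + y * (cnj u / of_real s) = a $ 1"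
        using cs unfolding s2[symmetric] by simp
      then show ?thesis unfolding L N by (simp add: scaleR_conv_of_real[where 'a = complex] field_simps)
    qed
    moreover have "(x *s field_L r p + y *s field_N r p) $ 2 = a $ 2"
    proof -
      have "(x * (- u / of_real s) + y * (cnj v / of_real s)) * (of_real s * of_real s)
         = - (x * of_real s) * u + (y * of_real s) * cnj v"
        using cs by (simp add: field_simps)
      also have "\<dots> = a $ 2 * (u * cnj u + v * cnj v)"
        unfolding xs ys by (simp add: algebra_simps)
      finally have "x * (- u / of_real s) + y * (cnj v / of_real s) = a $ 2"
        using cs unfolding s2[symmetric] by simp
      then show ?thesis unfolding L N by (simp add: scaleR_conv_of_real[where 'a = complex] field_simps)
    qed
    ultimately show "a = x *s field_L r p + y *s field_N r p"
      by (simp add: vec_eq_iff forall_2)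
    have "complex_of_real ((cmod x)\<^sup>2 + (cmod y)\<^sup>2) = of_real ((cmod (a $ 1))\<^sup>2 + (cmod (a $ 2))\<^sup>2)"
      using nm by (simp only: of_real_add complex_norm_square)
    then show "(cmod x)\<^sup>2 + (cmod y)\<^sup>2 = (norm a)\<^sup>2"
      unfolding of_real_eq_iff by (simp add: norm_vec_def L2_set_def sum_2)
    show "dz 1 r p * a $ 1 + dz 2 r p * a $ 2
        = y * of_real (sqrt ((cmod (dz 1 r p))\<^sup>2 + (cmod (dz 2 r p))\<^sup>2))"
      using ys by (simp add: s_def u_def v_def algebra_simps)
  qed
qed

text \<open>For real \<open>r\<close> the real and imaginary parts of the \<open>dz j r p\<close>
  are, up to factors 1/2 and -1/2, the four real partial derivatives.\<close>

lemma dz_nonzero_iff: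
  assumes "(r has_derivative r') (at p)"
  shows "0 < (cmod (dz 1 r p))\<^sup>2 + (cmod (dz 2 r p))\<^sup>2 \<longleftrightarrow> (\<exists>v. r' v \<noteq> 0)"
proof -
  have lin: "linear r'" using assms has_derivative_linear by blast
  have dz0: "dz j r p = 0 \<longleftrightarrow> r' (axis j 1) = 0 \<and> r' (axis j \<i>) = 0" for j
    by (auto simp: dz_eq[OF assms] complex_eq_iff)
  have r': "r' v = Re (v $ 1) * r' (axis 1 1) + Im (v $ 1) * r' (axis 1 \<i>)
      + Re (v $ 2) * r' (axis 2 1) + Im (v $ 2) * r' (axis 2 \<i>)" for v
  proof -
    have "v = Re (v $ 1) *\<^sub>R axis 1 1 + Im (v $ 1) *\<^sub>R axis 1 \<i>
      + Re (v $ 2) *\<^sub>R axis 2 1 + Im (v $ 2) *\<^sub>R axis 2 \<i>"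
      by (simp add: vec_eq_iff forall_2 axis_def complex_eq_iff)
    then have "r' v = r' (Re (v $ 1) *\<^sub>R axis 1 1 + Im (v $ 1) *\<^sub>R axis 1 \<i>
      + Re (v $ 2) *\<^sub>R axis 2 1 + Im (v $ 2) *\<^sub>R axis 2 \<i>)" by simp
    then show ?thesis by (simp add: linear_add[OF lin] linear_scale[OF lin])
  qed
  have "dz 1 r p = 0 \<and> dz 2 r p = 0 \<longleftrightarrow> (\<forall>v. r' v = 0)"
  proof
    assume z: "dz 1 r p = 0 \<and> dz 2 r p = 0"
    show "\<forall>v. r' v = 0"
    proof
      show "r' v = 0" for v using z r'[of v] unfolding dz0 by simp
    qed
  next
    assume "\<forall>v. r' v = 0"
    then show "dz 1 r p = 0 \<and> dz 2 r p = 0" unfolding dz0 by blast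
  qed
  then show ?thesis unfolding sum_power2_gt_zero_iff norm_eq_zero by blast
qed

lemma smooth_on_frame:
  assumes "open S" "smooth_on S r" "\<forall>p\<in>S. \<exists>v. frechet_derivative r (at p) v \<noteq> 0"
  shows "smooth_on S (field_L r)" "smooth_on S (field_N r)"
proof -
  \<comment> \<open>The squared length is written with products and conjugates so that its
    smoothness follows from the product rule. It is positive on \<open>S\<close>, so its power
    \<open>- (1/2)\<close>, the normalising factor, is smooth there.\<close>
  define s where "s p = Re (dz 1 r p * cnj (dz 1 r p) + dz 2 r p * cnj (dz 2 r p))" for p
  have s_eq: "s p = (cmod (dz 1 r p))\<^sup>2 + (cmod (dz 2 r p))\<^sup>2" for p
    unfolding s_def by (simp add: complex_norm_square[symmetric] del: complex_mult_cnj)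
  have s: "s p > 0" if "p \<in> S" for p
    unfolding s_eq using dz_nonzero_iff[OF smooth_on_has_derivative[OF assms(2) that]] assms(3) that
    by blast
  have "smooth_on S (\<lambda>p. Re (dz 1 r p * cnj (dz 1 r p) + dz 2 r p * cnj (dz 2 r p)))"
    using assms(1,2) by (intro smooth_on_bounded_linear_compose[OF _ bounded_linear_Re]
        smooth_on_add smooth_on_mult smooth_on_dz smooth_on_cnj)
  then have powr: "smooth_on S (\<lambda>p. s p powr (- (1/2)))"
    unfolding s_def[symmetric] using s assms(1) by (intro smooth_on_powr)
  have ax: "smooth_on S (\<lambda>p. axis j (f p) :: complex ^ 2)" if "smooth_on S f" for f j
  proof -
    have "linear (axis j :: complex \<Rightarrow> complex ^ 2)"
      by (auto intro!: linearI simp: axis_def vec_eq_iff)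
    then show ?thesis
      using smooth_on_bounded_linear_compose[OF assms(1) _ that]
      by (simp add: linear_conv_bounded_linear)
  qed
  have eq: "s p powr (- (1/2)) *\<^sub>R (axis 1 a + axis 2 b)
      = (1 / sqrt ((cmod (dz 1 r p))\<^sup>2 + (cmod (dz 2 r p))\<^sup>2)) *\<^sub>R (vector [a, b] :: complex ^ 2)" if "p \<in> S" for p a b
    using s[OF that]
    by (simp add: s_eq[symmetric] powr_minus_divide powr_half_sqrt vec_eq_iff forall_2 axis_def)
  have "smooth_on S (\<lambda>p. s p powr (- (1/2)) *\<^sub>R (axis 1 (dz 2 r p) + axis 2 (- dz 1 r p) :: complex ^ 2))"
    using assms(1,2) by (intro smooth_on_scaleR powr smooth_on_add ax smooth_on_dz smooth_on_minus)
  then show "smooth_on S (field_L r)"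
    by (rule smooth_on_cong[OF assms(1), rotated]) (simp add: eq field_L_def)
  have "smooth_on S (\<lambda>p. s p powr (- (1/2)) *\<^sub>R (axis 1 (dzbar 1 r p) + axis 2 (dzbar 2 r p) :: complex ^ 2))"
    using assms(1,2) by (intro smooth_on_scaleR powr smooth_on_add ax smooth_on_dzbar)
  then show "smooth_on S (field_N r)"
    by (rule smooth_on_cong[OF assms(1), rotated]) (simp add: eq field_N_def)
qed

text \<open>The product rule, used twice. The terms with one derivative of \<open>g\<close> and one
  of \<open>r\<close> form a conjugate pair, which gives the real part and the factor 4. Large
  values of \<open>g\<close> gain in the direction \<open>N\<close>; a large Hessian of
  \<open>g\<close> gains \<open>r\<^sup>2\<close> in every direction.\<close>

lemma complex_hessian_perturbation:
  assumes S: "open S" "p \<in> S" and r: "smooth_on S r" and g: "smooth_on S g"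
  shows "Re (complex_hessian (\<lambda>x. r x + (r x)\<^sup>2 * g x) p a a) =
      (1 + 2 * r p * g p) * Re (complex_hessian r p a a)
      + 2 * g p * (cmod (dz 1 r p * a $ 1 + dz 2 r p * a $ 2))\<^sup>2
      + 4 * r p * Re ((dz 1 g p * a $ 1 + dz 2 g p * a $ 2) * cnj (dz 1 r p * a $ 1 + dz 2 r p * a $ 2))
      + (r p)\<^sup>2 * Re (complex_hessian g p a a)"
proof -
  let ?\<rho> = "\<lambda>x. r x + (r x)\<^sup>2 * g x"
  let ?R = "\<lambda>x. complex_of_real (r x)" and ?G = "\<lambda>x. complex_of_real (g x)"
  let ?d = "\<lambda>k x. dzbar k r x * (1 + 2 * (?R x * ?G x)) + ?R x * ?R x * dzbar k g x"
  have rder: "(r has_derivative frechet_derivative r (at x)) (at x)"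
    and gder: "(g has_derivative frechet_derivative g (at x)) (at x)" if "x \<in> S" for x
    using r g that by (auto intro: smooth_on_has_derivative)
  \<comment> \<open>The formula is established on all of \<open>S\<close>, not just at
    \<open>p\<close>, since it is differentiated once more.\<close>
  have bar: "?d k x = dzbar k ?\<rho> x" if x: "x \<in> S" for k x
  proof -
    have "(?\<rho> has_derivative (\<lambda>v. frechet_derivative r (at x) v
        + ((r x)\<^sup>2 * frechet_derivative g (at x) v + 2 * r x * frechet_derivative r (at x) v * g x))) (at x)"
      using rder[OF x] gder[OF x] by (auto intro!: derivative_eq_intros)
    from dzbar_eq[OF this] show ?thesis
      unfolding dzbar_eq[OF rder[OF x]] dzbar_eq[OF gder[OF x]]
      by (simp only:) (simp add: power2_eq_square field_simps)
  qed
  have diff: "dzbar k r differentiable (at p)" "dzbar k g differentiable (at p)"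
    "?R differentiable (at p)" "?G differentiable (at p)" for k
    using S r g by (auto intro!: smooth_on_differentiable[of S] smooth_on_dzbar smooth_on_of_real)
  have coeff: "wirtinger j (dzbar k ?\<rho>) p =
     (1 + 2 * r p * g p) * wirtinger j (dzbar k r) p + 2 * g p * dz j r p * cnj (dz k r p)
     + 2 * r p * (dz j g p * cnj (dz k r p) + dz j r p * cnj (dz k g p))
     + (r p)\<^sup>2 * wirtinger j (dzbar k g) p" for j k
  proof -
    have "wirtinger j (dzbar k ?\<rho>) p = wirtinger j (?d k) p"
      by (rule wirtinger_cong[OF _ S bar]) (intro derivative_intros diff)
    also have "\<dots> = wirtinger j (dzbar k r) p * (1 + 2 * (?R p * ?G p))
       + dzbar k r p * (2 * (dz j r p * ?G p + ?R p * dz j g p))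
       + ((dz j r p * ?R p + ?R p * dz j r p) * dzbar k g p + ?R p * ?R p * wirtinger j (dzbar k g) p)"
      by (simp add: wirtinger_add wirtinger_mult wirtinger_const diff dz_def[symmetric])
    also have "\<dots> = (1 + 2 * r p * g p) * wirtinger j (dzbar k r) p + 2 * g p * dz j r p * cnj (dz k r p)
     + 2 * r p * (dz j g p * cnj (dz k r p) + dz j r p * cnj (dz k g p))
     + (r p)\<^sup>2 * wirtinger j (dzbar k g) p"
      by (simp add: dzbar_eq_cnj_dz[OF rder[OF S(2)]] dzbar_eq_cnj_dz[OF gder[OF S(2)]]
          power2_eq_square algebra_simps)
    finally show ?thesis .
  qed
  have Re_of_real_mult: "Re (of_real s * z) = s * Re z" for s z by simp
  define \<alpha> where "\<alpha> = dz 1 r p * a $ 1 + dz 2 r p * a $ 2"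
  define \<beta> where "\<beta> = dz 1 g p * a $ 1 + dz 2 g p * a $ 2"
  have "complex_hessian ?\<rho> p a a = of_real (1 + 2 * r p * g p) * complex_hessian r p a a
     + of_real (2 * g p) * (\<alpha> * cnj \<alpha>) + of_real (2 * r p) * (\<beta> * cnj \<alpha> + cnj (\<beta> * cnj \<alpha>))
     + of_real ((r p)\<^sup>2) * complex_hessian g p a a"
    unfolding complex_hessian_def sum_2 coeff by (simp add: \<alpha>_def \<beta>_def algebra_simps)
  then have "Re (complex_hessian ?\<rho> p a a) = (1 + 2 * r p * g p) * Re (complex_hessian r p a a)
     + 2 * g p * Re (\<alpha> * cnj \<alpha>) + 2 * r p * (Re (\<beta> * cnj \<alpha>) + Re (cnj (\<beta> * cnj \<alpha>)))
     + (r p)\<^sup>2 * Re (complex_hessian g p a a)"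
    by (simp only: plus_complex.sel Re_of_real_mult)
  moreover have "Re (\<alpha> * cnj \<alpha>) = (cmod \<alpha>)\<^sup>2"
    by (simp add: complex_norm_square[symmetric] del: complex_mult_cnj)
  moreover have "Re (cnj (\<beta> * cnj \<alpha>)) = Re (\<beta> * cnj \<alpha>)" by (simp only: cnj.sel)
  ultimately show ?thesis unfolding \<alpha>_def[symmetric] \<beta>_def[symmetric] by simp
qed

text \<open>The squared distance serves as the strictly plurisubharmonic weight with constant
  Hessian. Its first derivatives scale with the same \<open>M\<close> as its Hessian, so the mixed
  terms they cause remain comparable to the gain.\<close>

lemma quadratic_weight:
  fixes c :: "complex ^ 2"
  defines "g \<equiv> \<lambda>K M x. K + M * (norm (x - c))\<^sup>2"
  shows "open S \<Longrightarrow> smooth_on S (g K M)"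
    and "dz j (g K M) p = M * cnj (p $ j - c $ j)"
    and "complex_hessian (g K M) p a a = of_real (M * (norm a)\<^sup>2)"
proof -
  show "smooth_on S (g K M)" if "open S"
  proof -
    have "smooth_on S (\<lambda>x. x + (- c))"
      using that by (intro smooth_on_add smooth_on_const smooth_on_bounded_linear bounded_linear_ident)
    then have "smooth_on S (\<lambda>x. (x + (- c)) \<bullet> (x + (- c)))"
      using that by (intro smooth_on_inner)
    from smooth_on_add[OF that smooth_on_const smooth_on_mult[OF that smooth_on_const this]]
    have "smooth_on S (\<lambda>x. K + M * ((x + (- c)) \<bullet> (x + (- c))))" .
    then show ?thesis by (simp add: g_def power2_norm_eq_inner)
  qed
  have der: "(g K M has_derivative (\<lambda>v. M * (2 * ((x - c) \<bullet> v)))) (at x)" for x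
    unfolding g_def power2_norm_eq_inner
    by (auto intro!: derivative_eq_intros simp: inner_commute)
  have bar: "dzbar k (g K M) = (\<lambda>x. M * (x $ k - c $ k))" for k
    by (rule ext) (simp add: dzbar_eq[OF der] inner_axis complex_eq_iff inner_complex_def)
  show "dz j (g K M) p = M * cnj (p $ j - c $ j)"
    by (simp add: dz_eq[OF der] inner_axis complex_eq_iff inner_complex_def field_simps)
  have "wirtinger j (dzbar k (g K M)) p = (if j = k then of_real M else 0)" for j k
  proof -
    have "((\<lambda>x. M * (x $ k - c $ k)) has_derivative (\<lambda>v. M * (v $ k))) (at p)"
      by (auto intro!: derivative_eq_intros bounded_linear_imp_has_derivative bounded_linear_vec_nth)
    from wirtinger_eq[OF this, of j] show ?thesis
      unfolding bar by (simp only:) (auto simp: axis_def complex_eq_iff)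
  qed
  then have "complex_hessian (g K M) p a a = of_real M * (a $ 1 * cnj (a $ 1) + a $ 2 * cnj (a $ 2))"
    by (simp add: complex_hessian_def sum_2 algebra_simps)
  also have "\<dots> = of_real (M * (norm a)\<^sup>2)"
    by (simp only: complex_norm_square[symmetric] of_real_mult of_real_add[symmetric])
      (simp add: norm_vec_def L2_set_def sum_2)
  finally show "complex_hessian (g K M) p a a = of_real (M * (norm a)\<^sup>2)" .
qed

subsection \<open>Nearest boundary points\<close>

text \<open>Riesz representation in the standard basis gives existence for the \<open>THE\<close>
  description of the gradient, uniqueness of derivatives gives the rest.\<close>

lemma gradient_inner:
  assumes "(r has_derivative r') (at p)"
  shows "r' v = gradient r p \<bullet> v"
proof -
  have lin: "linear r'" using assms has_derivative_linear by blast
  define g where "g = (\<Sum>b\<in>Basis. r' b *\<^sub>R b)"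
  have g: "r' v = v \<bullet> g" for v
  proof -
    have "r' v = r' (\<Sum>b\<in>Basis. (v \<bullet> b) *\<^sub>R b)" by (simp add: euclidean_representation)
    then show ?thesis
      by (simp add: linear_sum[OF lin] linear_scale[OF lin] g_def inner_sum_right mult.commute)
  qed
  then have gd: "GDERIV r p :> g" using assms by (simp add: gderiv_def g[abs_def])
  have "gradient r p = g"
    unfolding gradient_def
  proof (rule the_equality)
    show "GDERIV r p :> g" by (fact gd)
  next
    fix h assume "GDERIV r p :> h"
    then have "(\<lambda>v. v \<bullet> h) = (\<lambda>v. v \<bullet> g)"
      using gd unfolding gderiv_def by (rule has_derivative_unique)
    then show "h = g" by (metis vector_eq_ldot)
  qed
  then show ?thesis by (simp add: g inner_commute)
qed

text \<open>\<open>r\<close> has constant sign on the part in \<open>U\<close> of the open ball around \<open>p\<close> through \<open>q\<close>, so its derivative at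
  \<open>q\<close> has constant sign on the half-space of directions pointing into the ball.\<close>
lemma nearest_frontier_point:
  fixes g :: "'a::euclidean_space"
  assumes r: "(r has_derivative (\<lambda>v. g \<bullet> v)) (at q)" and U: "open U" "q \<in> U" "r q = 0"
    and \<Omega>: "\<Omega> \<inter> U = {x \<in> U. r x < 0}"
    and near: "ball p (dist p q) \<inter> frontier \<Omega> = {}" and "g \<noteq> 0"
  obtains c where "p - q = c *\<^sub>R g"
proof -
  obtain d where d: "d > 0" "ball q d \<subseteq> U" using U open_contains_ball by blast
  have side: "ball p (dist p q) \<subseteq> \<Omega> \<or> ball p (dist p q) \<inter> \<Omega> = {}"
    using connected_Int_frontier[OF connected_ball, of p "dist p q" \<Omega>] near by blast
  \<comment> \<open>The sign tells the side: \<open>\<sigma> = 1\<close> if the ball lies inside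
    \<open>\<Omega>\<close>, \<open>\<sigma> = -1\<close> if it lies outside.\<close>
  obtain \<sigma> :: real where \<sigma>: "\<sigma> = 1 \<or> \<sigma> = -1"
    "\<And>x. x \<in> ball p (dist p q) \<Longrightarrow> x \<in> U \<Longrightarrow> \<sigma> * r x \<le> 0"
    using side
  proof
    assume "ball p (dist p q) \<subseteq> \<Omega>"
    then have "x \<in> ball p (dist p q) \<Longrightarrow> x \<in> U \<Longrightarrow> r x < 0" for x using \<Omega> by blast
    then show thesis by (intro that[of 1]) (auto intro: less_imp_le)
  next
    assume "ball p (dist p q) \<inter> \<Omega> = {}"
    then have "x \<in> ball p (dist p q) \<Longrightarrow> x \<in> U \<Longrightarrow> \<not> r x < 0" for x using \<Omega> by blast
    then show thesis by (intro that[of "-1"]) (auto simp: not_less)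
  qed
  have half: "\<sigma> * (g \<bullet> v) \<le> 0" if v: "0 < (p - q) \<bullet> v" for v
  proof (rule ccontr)
    assume "\<not> ?thesis"
    moreover have "((\<lambda>s. r (q + s *\<^sub>R v)) has_real_derivative g \<bullet> v) (at 0)"
      by (rule has_real_derivative_along_line[where c = "\<lambda>s. q + s *\<^sub>R v"])
        (use r in \<open>auto intro!: derivative_eq_intros\<close>)
    then have "((\<lambda>s. \<sigma> * r (q + s *\<^sub>R v)) has_real_derivative \<sigma> * (g \<bullet> v)) (at 0)"
      by (rule DERIV_cmult)
    ultimately have "\<exists>e>0. \<forall>h>0. h < e \<longrightarrow> \<sigma> * r (q + 0 *\<^sub>R v) < \<sigma> * r (q + (0 + h) *\<^sub>R v)"
      by (intro DERIV_pos_inc_right) (auto simp: not_le)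
    then obtain e where e: "e > 0" "\<And>h. h > 0 \<Longrightarrow> h < e \<Longrightarrow> 0 < \<sigma> * r (q + h *\<^sub>R v)"
      using U(3) by auto
    have v0: "norm v > 0" using v by auto
    \<comment> \<open>Three demands on the step: it stays where the derivative determines the sign
      of \<open>r\<close>, it stays in \<open>U\<close>, and by the last bound
      \<open>q + h *\<^sub>R v\<close> stays in the ball around \<open>p\<close>.\<close>
    define h where "h = min (e / 2) (min (d / (2 * norm v)) ((p - q) \<bullet> v / (norm v)\<^sup>2))"
    have h: "h > 0" "h < e" "h * norm v < d" "h * (norm v)\<^sup>2 \<le> (p - q) \<bullet> v"
    proof -
      show "h > 0" using e d v v0 by (simp add: h_def)
      show "h < e" using e by (simp add: h_def)
      have "h * norm v \<le> d / (2 * norm v) * norm v" using v0 by (intro mult_right_mono) (auto simp: h_def)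
      then show "h * norm v < d" using v0 d by simp
      have "h * (norm v)\<^sup>2 \<le> (p - q) \<bullet> v / (norm v)\<^sup>2 * (norm v)\<^sup>2"
        by (intro mult_right_mono) (auto simp: h_def)
      then show "h * (norm v)\<^sup>2 \<le> (p - q) \<bullet> v" using v0 by simp
    qed
    have "q + h *\<^sub>R v \<in> U" using d h by (auto simp: dist_norm)
    moreover have "q + h *\<^sub>R v \<in> ball p (dist p q)"
    proof -
      have "(norm (p - q - h *\<^sub>R v))\<^sup>2 = (norm (p - q))\<^sup>2 - 2 * h * ((p - q) \<bullet> v) + h * (h * (norm v)\<^sup>2)"
        unfolding power2_norm_eq_inner
        by (simp only: inner_diff_left inner_diff_right inner_scaleR_left inner_scaleR_right)
          (simp add: algebra_simps inner_commute)
      also have "\<dots> \<le> (norm (p - q))\<^sup>2 - h * ((p - q) \<bullet> v)"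
        using mult_left_mono[OF h(4), of h] h(1) by simp
      also have "\<dots> < (norm (p - q))\<^sup>2" using h(1) v by simp
      finally have "norm (p - q - h *\<^sub>R v) < norm (p - q)"
        using power2_less_imp_less norm_ge_zero by blast
      then show ?thesis by (simp add: dist_norm algebra_simps)
    qed
    ultimately show False using \<sigma>(2) e(2)[OF h(1,2)] by force
  qed
  show thesis
  proof (cases "p = q")
    case True
    then show ?thesis using that[of 0] by simp
  next
    case False
    then have n: "p - q \<noteq> 0" "(p - q) \<bullet> (p - q) > 0" by auto
    \<comment> \<open>All vectors \<open>(p - q) + l *\<^sub>R w\<close> point into the ball, so by
      \<open>half\<close> an affine function of \<open>l\<close> is never positive and its slope
      vanishes. The \<open>l\<close> chosen below would give it the value 1.\<close>
    have perp: "g \<bullet> w = 0" if w: "(p - q) \<bullet> w = 0" for w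
    proof (rule ccontr)
      assume gw: "g \<bullet> w \<noteq> 0"
      have "\<sigma> * (g \<bullet> (p - q)) + l * (\<sigma> * (g \<bullet> w)) \<le> 0" for l
        using half[of "(p - q) + l *\<^sub>R w"] n(2) w
        by (simp only: inner_add_right inner_scaleR_right) (simp add: algebra_simps)
      from this[of "(1 - \<sigma> * (g \<bullet> (p - q))) / (\<sigma> * (g \<bullet> w))"] show False
        using gw \<sigma>(1) by auto
    qed
    \<comment> \<open>\<open>k *\<^sub>R (p - q)\<close> is the orthogonal projection of
      \<open>g\<close>. The remainder is orthogonal to \<open>p - q\<close>, hence by
      \<open>perp\<close> also to \<open>g\<close>, hence to itself.\<close>
    define k where "k = (g \<bullet> (p - q)) / ((p - q) \<bullet> (p - q))"
    have w0: "(p - q) \<bullet> (g - k *\<^sub>R (p - q)) = 0"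
      using n by (simp add: k_def inner_diff_right[of "p - q" g] inner_commute)
    have "(g - k *\<^sub>R (p - q)) \<bullet> (g - k *\<^sub>R (p - q)) = g \<bullet> (g - k *\<^sub>R (p - q)) - k * ((p - q) \<bullet> (g - k *\<^sub>R (p - q)))"
      by (simp only: inner_diff_left inner_scaleR_left)
    then have "g = k *\<^sub>R (p - q)" using perp[OF w0] w0 by simp
    then show ?thesis using \<open>g \<noteq> 0\<close> that[of "1 / k"] by (cases "k = 0") auto
  qed
qed

subsection \<open>Local defining functions\<close>

text \<open>An open domain contains none of its frontier points, so \<open>r p\<close> is not
  negative. Were it positive, \<open>r\<close> would be positive near \<open>p\<close>, where the
  closure supplies points of \<open>\<Omega>\<close>.\<close>

lemma local_defining_function_zero:
  assumes "open \<Omega>" "local_defining_function \<Omega> p\<^sub>0 U r" "p \<in> frontier \<Omega>" "p \<in> U"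
  shows "r p = 0"
proof (rule antisym)
  have U: "open U" "smooth_on U r" "\<Omega> \<inter> U = {x \<in> U. r x < 0}"
    using assms(2) by (auto simp: local_defining_function_def)
  have "p \<notin> \<Omega>" using assms(1,3) by (simp add: frontier_def interior_open)
  then show "0 \<le> r p" using U(3) assms(4) by (auto simp: not_less[symmetric])
  show "r p \<le> 0"
  proof (rule ccontr)
    assume "\<not> r p \<le> 0"
    have cont: "continuous_on U r" using U(2) by (rule smooth_on_imp_continuous_on)
    have "open {x \<in> U. 0 < r x}"
      using continuous_open_preimage[OF cont U(1) open_greaterThan[of "0::real"]]
      by (simp add: vimage_def Int_def)
    moreover have "p \<in> {x \<in> U. 0 < r x}" using \<open>\<not> r p \<le> 0\<close> assms(4) by simp
    moreover have "p \<in> closure \<Omega>" using assms(3) by (simp add: frontier_def)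
    ultimately obtain x where "x \<in> \<Omega>" "x \<in> U" "0 < r x"
      using open_Int_closure_eq_empty[of "{x \<in> U. 0 < r x}" \<Omega>] by auto
    moreover from this(1,2) have "r x < 0" using U(3) by blast
    ultimately show False by simp
  qed
qed

lemma local_defining_function_subset:
  assumes "local_defining_function \<Omega> p\<^sub>0 U r" "open V" "p\<^sub>0 \<in> V" "V \<subseteq> U"
  shows "local_defining_function \<Omega> p\<^sub>0 V r"
  using assms unfolding local_defining_function_def
  by (auto intro: smooth_on_subset)

text \<open>Continuity of a single directional derivative suffices, so one direction
  \<open>u\<close> serves a whole ball and \<open>m\<close> is a uniform lower bound for the
  gradient there. The sign in \<open>u\<close> makes the derivative positive.\<close>

lemma derivative_nonzero_near:
  fixes r :: "'a::real_normed_vector \<Rightarrow> real"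
  assumes "open U" "smooth_on U r" "p \<in> U" "frechet_derivative r (at p) v \<noteq> 0"
  obtains e m u where "0 < e" "0 < m" "norm u = 1" "cball p e \<subseteq> U"
    "\<And>x. x \<in> cball p e \<Longrightarrow> m \<le> frechet_derivative r (at x) u"
proof -
  let ?D = "frechet_derivative r (at p)"
  have lin: "linear ?D" using smooth_on_has_derivative[OF assms(2,3)] has_derivative_linear by blast
  have v0: "v \<noteq> 0" using assms(4) linear_0[OF lin] by auto
  define u where "u = (sgn (?D v) / norm v) *\<^sub>R v"
  have u: "norm u = 1" using v0 assms(4) by (simp add: u_def abs_sgn_eq)
  have "?D u = \<bar>?D v\<bar> / norm v"
    unfolding u_def linear_scale[OF lin] by (simp add: sgn_mult_self_eq abs_sgn mult.commute)
  then have pos: "?D u > 0" using v0 assms(4) by simp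
  have "isCont (\<lambda>x. frechet_derivative r (at x) u) p"
    using smooth_on_imp_continuous_on[OF smooth_on_derivative[OF assms(2)]]
      assms(1,3) continuous_on_eq_continuous_at by blast
  then obtain d where d: "d > 0"
    "\<And>x. dist x p < d \<Longrightarrow> dist (frechet_derivative r (at x) u) (?D u) < ?D u / 2"
    using half_gt_zero[OF pos] unfolding continuous_at_eps_delta by blast
  obtain e1 where e1: "e1 > 0" "cball p e1 \<subseteq> U" using assms(1,3) open_contains_cball by blast
  show thesis
  proof (rule that[of "min e1 (d/2)" "?D u / 2" u])
    show "?D u / 2 \<le> frechet_derivative r (at x) u" if "x \<in> cball p (min e1 (d/2))" for x
    proof -
      have "dist x p < d" using that d(1) by (auto simp: dist_commute)
      from d(2)[OF this] show ?thesis unfolding dist_real_def by linarith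
    qed
  qed (use e1 d pos u in auto)
qed

section \<open>The Hessian of a defining function in the canonical frame\<close>

lemma hess_smooth:
  assumes "open S" "smooth_on S r" "\<forall>p\<in>S. \<exists>v. frechet_derivative r (at p) v \<noteq> 0"
  shows "smooth_on S (hess_LL r)" "smooth_on S (hess_LN r)"
    "smooth_on S (\<lambda>p. complex_hessian r p (field_N r p) (field_N r p))"
    "smooth_on S (\<lambda>p. Re (hess_LL r p))"
proof -
  note frame = smooth_on_frame[OF assms]
  show LL: "smooth_on S (hess_LL r)"
    unfolding hess_LL_def[abs_def] by (intro smooth_on_complex_hessian assms frame)
  show "smooth_on S (hess_LN r)"
    unfolding hess_LN_def[abs_def] by (intro smooth_on_complex_hessian assms frame)
  show "smooth_on S (\<lambda>p. complex_hessian r p (field_N r p) (field_N r p))"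
    by (intro smooth_on_complex_hessian assms frame)
  show "smooth_on S (\<lambda>p. Re (hess_LL r p))"
    by (rule smooth_on_bounded_linear_compose[OF assms(1) bounded_linear_Re LL])
qed

lemma hess_LL_real:
  assumes "open S" "smooth_on S r" "x \<in> S"
  shows "hess_LL r x = of_real (Re (hess_LL r x))"
  unfolding hess_LL_def by (rule complex_hessian_real[OF assms])

text \<open>Taylor's and Glaeser's inequalities concern real functions, whereas
  \<open>hess_LL r\<close> has complex type with real values; this passes from one to the
  other.\<close>

lemma hess_LL_derivative:
  assumes "open S" "smooth_on S r" "\<forall>p\<in>S. \<exists>v. frechet_derivative r (at p) v \<noteq> 0" "x \<in> S"
  shows "frechet_derivative (hess_LL r) (at x) v
    = of_real (frechet_derivative (\<lambda>p. Re (hess_LL r p)) (at x) v)"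
proof -
  have "((\<lambda>p. complex_of_real (Re (hess_LL r p))) has_derivative
     (\<lambda>v. of_real (frechet_derivative (\<lambda>p. Re (hess_LL r p)) (at x) v))) (at x)"
    using smooth_on_has_derivative[OF hess_smooth(4)[OF assms(1-3)] assms(4)]
    by (rule has_derivative_of_real)
  then have "(hess_LL r has_derivative
     (\<lambda>v. of_real (frechet_derivative (\<lambda>p. Re (hess_LL r p)) (at x) v))) (at x)"
    by (rule has_derivative_transform_within_open[OF _ assms(1,4)])
      (use hess_LL_real[OF assms(1,2)] in simp)
  then show ?thesis by (simp add: frechet_derivative_eqI)
qed

text \<open>The norm is 1 except where the gradient is zero; there division by zero makes the field
  zero.\<close>

lemma norm_normal_field_le: "norm (normal_field r p) \<le> 1"
  by (simp add: normal_field_def)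

section \<open>Plurisubharmonicity implies the two estimates\<close>

lemma psh_imp_bigo:
  assumes ldf: "local_defining_function \<Omega> p\<^sub>0 U r"
    and psh: "\<And>p a. p \<in> U \<Longrightarrow> 0 \<le> Re (complex_hessian r p a a)"
  shows "bigo_on (frontier \<Omega> \<inter> U) (\<lambda>p. (cmod (hess_LN r p))\<^sup>2) (hess_LL r)" (is ?LN)
    and "bigo_on (frontier \<Omega> \<inter> U) (\<lambda>p. (cmod (normal_deriv_hess_LL r p))\<^sup>2) (hess_LL r)" (is ?\<nu>)
proof -
  let ?f = "\<lambda>p. Re (hess_LL r p)"
  let ?NN = "\<lambda>p. complex_hessian r p (field_N r p) (field_N r p)"
  have U: "open U" "smooth_on U r" using ldf by (auto simp: local_defining_function_def)
  \<comment> \<open>The frame is smooth where \<open>dr\<close> does not vanish, which persists from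
    the frontier to nearby points. The radius \<open>2 * e\<close> leaves room for the closed ball
    of radius \<open>e\<close> used below.\<close>
  have loc: "\<exists>e>0. ball p (2 * e) \<subseteq> U \<and> (\<forall>x\<in>ball p (2 * e). \<exists>v. frechet_derivative r (at x) v \<noteq> 0)"
    if p: "p \<in> frontier \<Omega> \<inter> U" for p
  proof -
    have pU: "p \<in> U" using p by blast
    obtain v where v: "frechet_derivative r (at p) v \<noteq> 0"
      using ldf p by (auto simp: local_defining_function_def)
    obtain e m u where e: "0 < e" "0 < m" "norm u = 1" "cball p e \<subseteq> U"
      "\<And>x. x \<in> cball p e \<Longrightarrow> m \<le> frechet_derivative r (at x) u"
      by (rule derivative_nonzero_near[OF U pU v]) blast
    have "ball p (2 * (e/2)) \<subseteq> cball p e" by auto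
    then have "ball p (2 * (e/2)) \<subseteq> U"
      "\<forall>x\<in>ball p (2 * (e/2)). \<exists>v. frechet_derivative r (at x) v \<noteq> 0"
      using e(2,4,5) by (blast, metis subsetD not_less)
    then show ?thesis using e(1) half_gt_zero by blast
  qed
  have nn: "0 \<le> ?f x" if "x \<in> U" for x using psh[OF that] by (simp add: hess_LL_def)
  have nrm: "cmod (hess_LL r x) = ?f x" if "x \<in> U" for x
    using hess_LL_real[OF U that] nn[OF that] by (metis norm_of_real abs_of_nonneg)
  show ?LN
  proof (rule bigo_on_local)
    fix p assume p: "p \<in> frontier \<Omega> \<inter> U"
    obtain e where e: "e > 0" "ball p (2 * e) \<subseteq> U"
      "\<forall>x\<in>ball p (2 * e). \<exists>v. frechet_derivative r (at x) v \<noteq> 0"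
      using loc[OF p] by blast
    have ce: "cball p e \<subseteq> ball p (2 * e)" using e(1) by auto
    have "continuous_on (cball p e) ?NN"
      using smooth_on_imp_continuous_on[OF hess_smooth(3)[OF open_ball smooth_on_subset[OF U(2) e(2)] e(3)]]
      by (rule continuous_on_subset[OF _ ce])
    then have "bounded (?NN ` cball p e)"
      by (intro compact_imp_bounded compact_continuous_image) auto
    then obtain C where C: "\<And>x. x \<in> cball p e \<Longrightarrow> cmod (?NN x) \<le> C"
      unfolding bounded_iff by blast
    have "norm ((cmod (hess_LN r x))\<^sup>2) \<le> C * norm (hess_LL r x)" if "x \<in> ball p e" for x
    proof -
      have "x \<in> cball p e" using that by simp
      moreover from this have "x \<in> U" using ce e(2) by blast
      ultimately have x: "x \<in> U" "x \<in> cball p e" by auto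
      have "(cmod (hess_LN r x))\<^sup>2 \<le> ?f x * Re (?NN x)"
        unfolding hess_LN_def hess_LL_def
        by (rule complex_hessian_cauchy_schwarz[OF U x(1) psh[OF x(1)]])
      also have "\<dots> \<le> ?f x * C"
        using C[OF x(2)] complex_Re_le_cmod[of "?NN x"] by (intro mult_left_mono nn x) linarith
      finally show ?thesis using nrm[OF x(1)] by (simp add: mult.commute)
    qed
    then show "\<exists>e>0. \<exists>C. \<forall>x\<in>ball p e. norm ((cmod (hess_LN r x))\<^sup>2) \<le> C * norm (hess_LL r x)"
      using e(1) by blast
  qed
  show ?\<nu>
  proof (rule bigo_on_local)
    fix p assume p: "p \<in> frontier \<Omega> \<inter> U"
    obtain e where e: "e > 0" "ball p (2 * e) \<subseteq> U"
      "\<forall>x\<in>ball p (2 * e). \<exists>v. frechet_derivative r (at x) v \<noteq> 0"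
      using loc[OF p] by blast
    have ce: "cball p e \<subseteq> ball p (2 * e)" using e(1) by auto
    note S = open_ball smooth_on_subset[OF U(2) e(2)] e(3)
    \<comment> \<open>Glaeser's inequality requires \<open>?f\<close> to be nonnegative on a full
      ball, including points off the frontier. Plurisubharmonicity on all of \<open>U\<close>
      provides this.\<close>
    obtain C where C: "0 < C" "\<And>x v. x \<in> cball p (e/2) \<Longrightarrow> norm v \<le> 1
        \<Longrightarrow> (frechet_derivative ?f (at x) v)\<^sup>2 \<le> C * ?f x"
      by (rule smooth_on_glaeser[OF hess_smooth(4)[OF S] ce e(1)]) (use nn ce e(2) in blast)+
    have "norm ((cmod (normal_deriv_hess_LL r x))\<^sup>2) \<le> C * norm (hess_LL r x)" if "x \<in> ball p (e/2)" for x
    proof -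
      have x: "x \<in> cball p (e/2)" "x \<in> ball p (2 * e)" using that e(1) by auto
      show ?thesis
        using C(2)[OF x(1) norm_normal_field_le[of r x]] nrm[of x] x(2) e(2)
        unfolding normal_deriv_hess_LL_def hess_LL_derivative[OF S x(2)] norm_of_real
        by (simp add: subset_iff)
    qed
    then show "\<exists>e>0. \<exists>C. \<forall>x\<in>ball p e. norm ((cmod (normal_deriv_hess_LL r x))\<^sup>2) \<le> C * norm (hess_LL r x)"
      using e(1) half_gt_zero by blast
  qed
qed

section \<open>The two estimates imply plurisubharmonicity\<close>

lemma pseudoconvex_hess_LL_nonneg:
  assumes "pseudoconvex \<Omega>" "local_defining_function \<Omega> p\<^sub>0 U r"
    and "\<forall>x\<in>U. \<exists>v. frechet_derivative r (at x) v \<noteq> 0" "p \<in> frontier \<Omega>" "p \<in> U"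
  shows "0 \<le> Re (hess_LL r p)"
proof -
  \<comment> \<open>\<open>pseudoconvex\<close> asks for a field smooth on all of \<open>U\<close>,
    which is why \<open>dr\<close> is assumed nonzero throughout \<open>U\<close>.\<close>
  have "smooth_on U (field_L r)"
    using assms(2,3) by (intro smooth_on_frame) (auto simp: local_defining_function_def)
  moreover have "\<forall>p \<in> frontier \<Omega> \<inter> U. (\<Sum>j\<in>UNIV. field_L r p $ j * dz j r p) = 0"
    by (simp add: sum_2 field_L_def mult.commute)
  ultimately have "\<forall>p \<in> frontier \<Omega> \<inter> U. 0 \<le> Re (complex_hessian r p (field_L r p) (field_L r p))"
    using assms(1,2) unfolding pseudoconvex_def by blast
  then show ?thesis using assms(4,5) by (simp add: hess_LL_def)
qed

text \<open>The linear Taylor term of \<open>H\<^sub>r(L,L)\<close> along \<open>p - q\<close>, with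
  \<open>q\<close> the nearest boundary point, is a multiple of exactly the normal derivative that
  the second estimate controls; tangential derivatives do not enter.\<close>

lemma near_frontier_estimate:
  assumes \<Omega>: "open \<Omega>" "pseudoconvex \<Omega>" and ldf: "local_defining_function \<Omega> p\<^sub>0 U r"
    and LN: "bigo_on (frontier \<Omega> \<inter> U) (\<lambda>p. (cmod (hess_LN r p))\<^sup>2) (hess_LL r)"
    and \<nu>: "bigo_on (frontier \<Omega> \<inter> U) (\<lambda>p. (cmod (normal_deriv_hess_LL r p))\<^sup>2) (hess_LL r)"
  obtains e B where "0 < e" "0 < B" "cball p\<^sub>0 e \<subseteq> U"
    "\<forall>x\<in>cball p\<^sub>0 e. \<exists>v. frechet_derivative r (at x) v \<noteq> 0"
    "\<And>p. p \<in> cball p\<^sub>0 e \<Longrightarrow> (cmod (hess_LN r p))\<^sup>2 \<le> B * (Re (hess_LL r p) + B * (r p)\<^sup>2)"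
proof -
  let ?f = "\<lambda>p. Re (hess_LL r p)"
  have U: "open U" "smooth_on U r" "p\<^sub>0 \<in> U" "p\<^sub>0 \<in> frontier \<Omega>" "\<Omega> \<inter> U = {x \<in> U. r x < 0}"
    using ldf by (auto simp: local_defining_function_def)
  obtain v where v: "frechet_derivative r (at p\<^sub>0) v \<noteq> 0"
    using ldf U by (auto simp: local_defining_function_def)
  obtain d m u where d: "0 < d" "0 < m" "norm u = 1" "cball p\<^sub>0 d \<subseteq> U"
    "\<And>x. x \<in> cball p\<^sub>0 d \<Longrightarrow> m \<le> frechet_derivative r (at x) u"
    by (rule derivative_nonzero_near[OF U(1-3) v]) blast
  define S where "S = ball p\<^sub>0 d"
  have SU: "open S" "S \<subseteq> U" "p\<^sub>0 \<in> S" using d by (auto simp: S_def)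
  have "\<exists>v. frechet_derivative r (at x) v \<noteq> 0" if "x \<in> S" for x
    using d(2) d(5)[of x] that by (intro exI[of _ u]) (simp add: S_def)
  then have S: "open S" "smooth_on S r" "\<forall>x\<in>S. \<exists>v. frechet_derivative r (at x) v \<noteq> 0"
    using SU(1) smooth_on_subset[OF U(2) SU(2)] by blast+
  have ldfS: "local_defining_function \<Omega> p\<^sub>0 S r"
    by (rule local_defining_function_subset[OF ldf SU(1,3,2)])
  define \<delta> where "\<delta> = d / 2"
  have \<delta>: "0 < \<delta>" "cball p\<^sub>0 \<delta> \<subseteq> S" using d(1) by (auto simp: \<delta>_def S_def)
  \<comment> \<open>Nearest boundary points will lie in this compact set, so the two estimates hold
    at them with fixed constants \<open>C1\<close> and \<open>C2\<close>.\<close>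
  define K where "K = frontier \<Omega> \<inter> cball p\<^sub>0 \<delta>"
  have "compact K" unfolding K_def by (intro closed_Int_compact frontier_closed compact_cball)
  then have K: "compact (closure K) \<and> closure K \<subseteq> frontier \<Omega> \<inter> U"
    using \<delta> SU by (auto simp: K_def closure_closed compact_imp_closed)
  obtain C1 where C1: "C1 > 0" "\<And>q. q \<in> K \<Longrightarrow> norm ((cmod (hess_LN r q))\<^sup>2) \<le> C1 * norm (hess_LL r q)"
    using LN K unfolding bigo_on_def by blast
  obtain C2 where C2: "C2 > 0"
    "\<And>q. q \<in> K \<Longrightarrow> norm ((cmod (normal_deriv_hess_LL r q))\<^sup>2) \<le> C2 * norm (hess_LL r q)"
    using \<nu> K unfolding bigo_on_def by blast
  obtain C3 where C3: "0 \<le> C3" "\<And>x y. x \<in> cball p\<^sub>0 \<delta> \<Longrightarrow> y \<in> cball p\<^sub>0 \<delta>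
      \<Longrightarrow> \<bar>?f y - ?f x - frechet_derivative ?f (at x) (y - x)\<bar> \<le> C3 * (norm (y - x))\<^sup>2"
    by (rule smooth_on_taylor[OF hess_smooth(4)[OF S] \<delta>(2)]) blast
  obtain C4 where C4: "0 \<le> C4" "\<And>x y. x \<in> cball p\<^sub>0 \<delta> \<Longrightarrow> y \<in> cball p\<^sub>0 \<delta>
      \<Longrightarrow> \<bar>r y - r x - frechet_derivative r (at x) (y - x)\<bar> \<le> C4 * (norm (y - x))\<^sup>2"
    by (rule smooth_on_taylor[OF S(2) \<delta>(2)]) blast
  obtain C5 where C5: "0 \<le> C5" "\<And>x y. x \<in> cball p\<^sub>0 \<delta> \<Longrightarrow> y \<in> cball p\<^sub>0 \<delta>
      \<Longrightarrow> norm (hess_LN r y - hess_LN r x) \<le> C5 * norm (y - x)"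
    by (rule smooth_on_lipschitz[OF hess_smooth(2)[OF S] \<delta>(2)]) blast
  \<comment> \<open>The bound \<open>\<delta> / 2\<close> brings the nearest boundary point of each
    \<open>p\<close> considered into \<open>K\<close>. The other bound gives
    \<open>C4 * e \<le> m / 2\<close>, so that the linear Taylor term of \<open>r\<close> dominates
    the quadratic one.\<close>
  define e where "e = min (\<delta> / 2) (m / (2 * (C4 + 1)))"
  \<comment> \<open>One constant for all later uses: the first factor dominates every coefficient of
    \<open>F\<close> and \<open>t\<^sup>2\<close> that occurs, the second pays for replacing
    \<open>t\<^sup>2\<close> by \<open>(r p)\<^sup>2\<close>.\<close>
  define A where "A = (1 + 2 * C1 + 2 * C5\<^sup>2 + C2 / 2 + C3) * (1 + 4 / m\<^sup>2)"
  have e: "0 < e" "e \<le> \<delta> / 2" "C4 * e \<le> m / 2"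
  proof -
    show "0 < e" using \<delta>(1) d(2) C4(1) by (simp add: e_def)
    show "e \<le> \<delta> / 2" unfolding e_def by (rule min.cobounded1)
    have "(C4 + 1) * e \<le> (C4 + 1) * (m / (2 * (C4 + 1)))"
      using C4(1) by (intro mult_left_mono) (auto simp: e_def)
    also have "\<dots> = m / 2" using C4(1) by (simp add: field_simps)
    finally show "C4 * e \<le> m / 2" using \<open>0 < e\<close> by (simp add: algebra_simps)
  qed
  show thesis
  proof (rule that[of e "2 * A + 1"])
    show "0 < e" by fact
    have A0: "A \<ge> 0" unfolding A_def using C1(1) C2(1) C3(1) by (intro mult_nonneg_nonneg add_nonneg_nonneg) auto
    then show "0 < 2 * A + 1" by simp
    have ed: "cball p\<^sub>0 e \<subseteq> cball p\<^sub>0 \<delta>" using e \<delta> by auto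
    then show "cball p\<^sub>0 e \<subseteq> U" using \<delta> SU by blast
    show "\<forall>x\<in>cball p\<^sub>0 e. \<exists>v. frechet_derivative r (at x) v \<noteq> 0"
      using ed \<delta> S(3) by blast
    fix p assume p: "p \<in> cball p\<^sub>0 e"
    then have p\<delta>: "p \<in> cball p\<^sub>0 \<delta>" using ed by blast
    obtain q where q: "q \<in> frontier \<Omega>" "\<And>y. y \<in> frontier \<Omega> \<Longrightarrow> dist p q \<le> dist p y"
      using distance_attains_inf[OF frontier_closed, of \<Omega> p] U(4) by blast
    define t where "t = norm (p - q)"
    have t: "0 \<le> t" "t \<le> e" using q(2)[OF U(4)] p by (auto simp: t_def dist_norm norm_minus_commute)
    have "dist p\<^sub>0 q \<le> dist p\<^sub>0 p + dist p q" by (rule dist_triangle)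
    also have "\<dots> \<le> e + e" using p t by (auto simp: t_def dist_norm)
    finally have q\<delta>: "q \<in> cball p\<^sub>0 \<delta>" using e(2) by simp
    then have qS: "q \<in> S" "q \<in> K" using \<delta>(2) q(1) by (auto simp: K_def)
    have rq: "r q = 0" by (rule local_defining_function_zero[OF \<Omega>(1) ldfS q(1) qS(1)])
    define F where "F = ?f q"
    have F: "0 \<le> F"
      unfolding F_def by (rule pseudoconvex_hess_LL_nonneg[OF \<Omega>(2) ldfS S(3) q(1) qS(1)])
    have nF: "norm (hess_LL r q) = F"
      using hess_LL_real[OF S(1,2) qS(1)] F unfolding F_def by (metis norm_of_real abs_of_nonneg)
    define g where "g = gradient r q"
    have rder: "(r has_derivative frechet_derivative r (at q)) (at q)"
      by (rule smooth_on_has_derivative[OF S(2) qS(1)])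
    have Dr: "frechet_derivative r (at q) v = g \<bullet> v" for v
      unfolding g_def by (rule gradient_inner[OF rder])
    have gm: "m \<le> norm g"
    proof -
      have "m \<le> g \<bullet> u" using d(5)[of q] qS(1) by (simp add: S_def Dr)
      also have "\<dots> \<le> norm g * norm u" by (rule norm_cauchy_schwarz)
      finally show ?thesis using d(3) by simp
    qed
    have near: "ball p (dist p q) \<inter> frontier \<Omega> = {}"
      using q(2) by (auto simp: not_less[symmetric])
    obtain c where c: "p - q = c *\<^sub>R g"
    proof (rule nearest_frontier_point[where r = r and U = S and g = g, OF _ SU(1) qS(1) rq _ near])
      show "(r has_derivative (\<lambda>v. g \<bullet> v)) (at q)" using rder by (simp add: Dr[abs_def])
      show "\<Omega> \<inter> S = {x \<in> S. r x < 0}" using ldfS by (simp add: local_defining_function_def)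
      show "g \<noteq> 0" using gm d(2) by auto
    qed
    have tc: "t = \<bar>c\<bar> * norm g" by (simp add: t_def c)
    have pq: "p - q = (c * norm g) *\<^sub>R normal_field r q"
      using gm d(2) by (auto simp: normal_field_def g_def[symmetric] c)
    have "linear (frechet_derivative ?f (at q))"
      using smooth_on_has_derivative[OF hess_smooth(4)[OF S] qS(1)] has_derivative_linear by blast
    then have Df: "frechet_derivative ?f (at q) (p - q)
        = (c * norm g) * frechet_derivative ?f (at q) (normal_field r q)"
      unfolding pq by (simp add: linear_scale)
    have "(frechet_derivative ?f (at q) (normal_field r q))\<^sup>2 \<le> C2 * F"
      using C2(2)[OF qS(2)] nF
      by (simp add: normal_deriv_hess_LL_def hess_LL_derivative[OF S qS(1)])
    then have "t\<^sup>2 * (frechet_derivative ?f (at q) (normal_field r q))\<^sup>2 \<le> t\<^sup>2 * (C2 * F)"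
      by (rule mult_left_mono) simp
    then have "(frechet_derivative ?f (at q) (p - q))\<^sup>2 \<le> F * (C2 * t\<^sup>2)"
      unfolding Df tc by (simp add: power_mult_distrib mult_ac)
    \<comment> \<open>Arithmetic-geometric mean: the linear Taylor term costs only half of
      \<open>F\<close> and a multiple of \<open>t\<^sup>2\<close>, so half of \<open>F\<close>
      survives at \<open>p\<close>.\<close>
    also have "\<dots> \<le> ((F + C2 * t\<^sup>2) / 2)\<^sup>2"
      using arith_geo_mean[of "sqrt (F * (C2 * t\<^sup>2))" F "C2 * t\<^sup>2"]
        sum_squares_bound[of "F" "C2 * t\<^sup>2"] by (simp add: power2_eq_square field_simps)
    finally have Df': "\<bar>frechet_derivative ?f (at q) (p - q)\<bar> \<le> (F + C2 * t\<^sup>2) / 2"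
      using F C2(1) by (intro power2_le_imp_le[of "\<bar>_\<bar>"]) auto
    have f: "F / 2 - (C2 / 2 + C3) * t\<^sup>2 \<le> ?f p"
      using C3(2)[OF q\<delta> p\<delta>] Df' by (simp add: F_def t_def[symmetric] algebra_simps)
    \<comment> \<open>At \<open>q\<close> the slope of \<open>r\<close> along the normal is
      \<open>norm g\<close>, at least \<open>m\<close>. The Taylor error consumes at most
      \<open>m / 2\<close> of it, whence \<open>t * m / 2 \<le> \<bar>r p\<bar>\<close>.\<close>
    have rp: "m\<^sup>2 * t\<^sup>2 \<le> 4 * (r p)\<^sup>2"
    proof -
      have "\<bar>frechet_derivative r (at q) (p - q)\<bar> = t * norm g"
        unfolding Dr tc c by (simp add: abs_mult power2_norm_eq_inner[symmetric] power2_eq_square)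
      moreover have "t * m \<le> t * norm g" using gm t by (intro mult_left_mono)
      moreover have "C4 * t\<^sup>2 \<le> t * (m / 2)"
      proof -
        have "C4 * t \<le> C4 * e" using t C4(1) by (intro mult_left_mono)
        then have "t * (C4 * t) \<le> t * (m / 2)" using t e(3) by (intro mult_left_mono) auto
        then show ?thesis by (simp add: power2_eq_square mult_ac)
      qed
      ultimately have "t * m / 2 \<le> \<bar>r p\<bar>"
        using C4(2)[OF q\<delta> p\<delta>] rq by (simp add: t_def[symmetric])
      then have "(t * m / 2)\<^sup>2 \<le> (r p)\<^sup>2"
        using t d(2) by (metis abs_le_square_iff abs_of_nonneg divide_nonneg_nonneg less_imp_le
            mult_nonneg_nonneg zero_le_numeral)
      then show ?thesis by (simp add: power2_eq_square mult_ac)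
    qed
    then have t2: "t\<^sup>2 \<le> 4 / m\<^sup>2 * (r p)\<^sup>2" using d(2) by (simp add: field_simps)
    have t2A: "X * t\<^sup>2 \<le> A * (r p)\<^sup>2" if "0 \<le> X" "X \<le> 1 + 2 * C1 + 2 * C5\<^sup>2 + C2 / 2 + C3" for X
    proof -
      have "X * t\<^sup>2 \<le> (1 + 2 * C1 + 2 * C5\<^sup>2 + C2 / 2 + C3) * (4 / m\<^sup>2 * (r p)\<^sup>2)"
        using that by (intro mult_mono t2) auto
      also have "\<dots> \<le> A * (r p)\<^sup>2"
        unfolding A_def mult.assoc[symmetric]
        using that by (intro mult_right_mono mult_left_mono) auto
      finally show ?thesis .
    qed
    have f': "F / 2 \<le> ?f p + A * (r p)\<^sup>2"
      using f t2A[of "C2 / 2 + C3"] C1(1) C2(1) C3(1) by auto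
    \<comment> \<open>Moving from \<open>q\<close> to \<open>p\<close> changes
      \<open>hess_LN r\<close> by a multiple of \<open>t\<close>; after squaring this is of the
      order of the tolerated error \<open>(r p)\<^sup>2\<close>.\<close>
    have "(cmod (hess_LN r p))\<^sup>2 \<le> 2 * C1 * F + 2 * C5\<^sup>2 * t\<^sup>2"
    proof -
      have "cmod (hess_LN r p) \<le> cmod (hess_LN r q) + C5 * t"
        using C5(2)[OF q\<delta> p\<delta>] norm_triangle_sub[of "hess_LN r p" "hess_LN r q"] by (simp add: t_def)
      then have "(cmod (hess_LN r p))\<^sup>2 \<le> (cmod (hess_LN r q) + C5 * t)\<^sup>2"
        by (intro power_mono) auto
      also have "\<dots> \<le> 2 * (cmod (hess_LN r q))\<^sup>2 + 2 * (C5 * t)\<^sup>2"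
        using sum_squares_bound[of "cmod (hess_LN r q)" "C5 * t"] by (simp add: power2_sum)
      also have "(cmod (hess_LN r q))\<^sup>2 \<le> C1 * F" using C1(2)[OF qS(2)] nF by simp
      finally show ?thesis by (simp add: power_mult_distrib)
    qed
    also have "2 * C1 * F \<le> A * F"
    proof (rule mult_right_mono[OF _ F])
      have "2 * C1 \<le> (1 + 2 * C1 + 2 * C5\<^sup>2 + C2 / 2 + C3) * 1" using C2(1) C3(1) by simp
      also have "\<dots> \<le> A" unfolding A_def using C1(1) C2(1) C3(1) by (intro mult_left_mono) auto
      finally show "2 * C1 \<le> A" .
    qed
    also have "A * F \<le> A * (2 * (?f p + A * (r p)\<^sup>2))"
      using f' A0 by (intro mult_left_mono) auto
    also have "2 * C5\<^sup>2 * t\<^sup>2 \<le> A * (r p)\<^sup>2"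
      using C1(1) C2(1) C3(1) by (intro t2A) auto
    finally have "(cmod (hess_LN r p))\<^sup>2 \<le> 2 * A * (?f p + A * (r p)\<^sup>2) + A * (r p)\<^sup>2"
      by (simp add: algebra_simps)
    \<comment> \<open>A single constant is used in both places. The difference of the two sides is
      \<open>?f p + A * (r p)\<^sup>2\<close>, nonnegative by \<open>f'\<close>, plus a nonnegative
      multiple of \<open>(r p)\<^sup>2\<close>.\<close>
    also have "\<dots> \<le> (2 * A + 1) * (?f p + (2 * A + 1) * (r p)\<^sup>2)"
    proof -
      have "0 \<le> ?f p + A * (r p)\<^sup>2" using f' F by simp
      moreover have "0 \<le> (1 + 2 * A + 2 * A * A) * (r p)\<^sup>2" using A0 by simp
      ultimately show ?thesis by (simp add: algebra_simps)
    qed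
    finally show "(cmod (hess_LN r p))\<^sup>2 \<le> (2 * A + 1) * (?f p + (2 * A + 1) * (r p)\<^sup>2)" .
  qed
qed

text \<open>The real inequality behind the construction. \<open>X\<close> and \<open>Y\<close> are
  the moduli of the \<open>L\<close> and \<open>N\<close> components of a vector of length
  \<open>N\<close>, \<open>s\<close> is the size of \<open>N r\<close>, \<open>w\<close> that of
  \<open>H\<^sub>r(L,N)\<close>, and \<open>b\<close> that of the derivative of the weight along the
  vector.\<close>

lemma perturbation_estimate:
  fixes B M K n s h w f X Y r u b H :: real
  assumes H: "u * (X\<^sup>2 * f - 2 * X * Y * w - n * Y\<^sup>2) + 2 * K * (Y * s)\<^sup>2 - 4 * \<bar>r\<bar> * b * (Y * s)
      + r\<^sup>2 * (M * N\<^sup>2) \<le> H"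
    and w: "w\<^sup>2 \<le> B * (f + B * r\<^sup>2)" "0 < B" and u: "0 \<le> u" "u \<le> 3/2"
    and XY: "0 \<le> X" "0 \<le> Y" "N\<^sup>2 = X\<^sup>2 + Y\<^sup>2" "0 \<le> n" "0 \<le> N"
    and b: "0 \<le> b" "b \<le> M * N" and M: "M = 3 * B" and s: "0 \<le> s" "(B + n) \<le> (K - 4 * M) * s\<^sup>2"
  shows "0 \<le> H"
proof -
  \<comment> \<open>Young's inequality balanced by \<open>B\<close>. In \<open>G\<close> the term
    \<open>X\<^sup>2 * f\<close> then cancels entirely, so a negative \<open>f\<close> does no harm
    and only \<open>P\<close> and \<open>Q\<close> remain to be paid for.\<close>
  have Xw: "2 * X * Y * w \<le> X\<^sup>2 * (f + B * r\<^sup>2) + B * Y\<^sup>2"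
  proof -
    have "2 * (X * w) * (B * Y) \<le> (X * w)\<^sup>2 + (B * Y)\<^sup>2" by (rule sum_squares_bound)
    also have "(X * w)\<^sup>2 \<le> X\<^sup>2 * (B * (f + B * r\<^sup>2))"
      unfolding power_mult_distrib by (rule mult_left_mono[OF w(1)]) simp
    finally have "B * (2 * X * Y * w) \<le> B * (X\<^sup>2 * (f + B * r\<^sup>2) + B * Y\<^sup>2)"
      by (simp add: algebra_simps power2_eq_square)
    then show ?thesis using w(2) by simp
  qed
  define P Q T G where "P = B * r\<^sup>2 * X\<^sup>2" and "Q = (B + n) * Y\<^sup>2" and "T = (Y * s)\<^sup>2"
    and "G = X\<^sup>2 * f - 2 * X * Y * w - n * Y\<^sup>2"
  have "0 \<le> P" "0 \<le> Q" using w(2) XY by (auto simp: P_def Q_def)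
  have "- (P + Q) \<le> G"
    using Xw by (simp add: P_def Q_def G_def algebra_simps)
  then have "u * (- (P + Q)) \<le> u * G"
    by (rule mult_left_mono[OF _ u(1)])
  moreover have "u * (P + Q) \<le> 3/2 * (P + Q)"
    using u(2) \<open>0 \<le> P\<close> \<open>0 \<le> Q\<close> by (intro mult_right_mono) auto
  ultimately have "- (3/2 * (P + Q)) \<le> u * G"
    unfolding mult_minus_right by linarith
  \<comment> \<open>The factor 4 is put on \<open>Y * s\<close>, so that only half of the weight's
    Hessian is consumed and the rest is charged to \<open>K\<close>.\<close>
  moreover have "4 * \<bar>r\<bar> * b * (Y * s) \<le> r\<^sup>2 * (M * N\<^sup>2) / 2 + 8 * (M * T)"
  proof -
    have "4 * \<bar>r\<bar> * b * (Y * s) \<le> 4 * \<bar>r\<bar> * (M * N) * (Y * s)"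
      using b XY s by (intro mult_right_mono mult_left_mono) auto
    also have "\<dots> = M / 2 * (2 * (\<bar>r\<bar> * N) * (4 * (Y * s)))" by simp
    also have "\<dots> \<le> M / 2 * ((\<bar>r\<bar> * N)\<^sup>2 + (4 * (Y * s))\<^sup>2)"
      using M w(2) by (intro mult_left_mono sum_squares_bound) auto
    also have "\<dots> = r\<^sup>2 * (M * N\<^sup>2) / 2 + 8 * (M * T)"
      by (simp add: T_def power_mult_distrib algebra_simps)
    finally show ?thesis .
  qed
  moreover have "Q \<le> K * T - 4 * (M * T)"
    using mult_right_mono[OF s(2), of "Y\<^sup>2"]
    by (simp add: Q_def T_def power_mult_distrib algebra_simps)
  moreover have "3 * P \<le> r\<^sup>2 * (M * N\<^sup>2)"
    unfolding P_def M XY(3) using w(2) by (simp add: algebra_simps)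
  moreover have "u * G + 2 * (K * T) - 4 * \<bar>r\<bar> * b * (Y * s) + r\<^sup>2 * (M * N\<^sup>2) \<le> H"
    using H by (simp add: G_def T_def mult.assoc)
  \<comment> \<open>The balance, linear in abstract quantities: the remaining \<open>R / 2\<close>
    pays for \<open>3/2 * P\<close>, and \<open>2 * (k - 4 * m)\<close> covers \<open>2 * Q\<close>,
    which leaves \<open>Q / 2\<close>.\<close>
  moreover have "0 \<le> h" if "- (3/2 * (P + Q)) \<le> g" "e \<le> R / 2 + 8 * m" "Q \<le> k - 4 * m"
    "3 * P \<le> R" "g + 2 * k - e + R \<le> h" for g e R m k h
    using that \<open>0 \<le> Q\<close> by argo
  ultimately show ?thesis by blast
qed

lemma bigo_imp_psh:
  assumes \<Omega>: "open \<Omega>" "pseudoconvex \<Omega>" and ldf: "local_defining_function \<Omega> p\<^sub>0 U r"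
    and LN: "bigo_on (frontier \<Omega> \<inter> U) (\<lambda>p. (cmod (hess_LN r p))\<^sup>2) (hess_LL r)"
    and \<nu>: "bigo_on (frontier \<Omega> \<inter> U) (\<lambda>p. (cmod (normal_deriv_hess_LL r p))\<^sup>2) (hess_LL r)"
  obtains V \<rho> where "local_defining_function \<Omega> p\<^sub>0 V \<rho>"
    "\<And>p a. p \<in> V \<Longrightarrow> 0 \<le> Re (complex_hessian \<rho> p a a)"
proof -
  obtain e B where e: "0 < e" "cball p\<^sub>0 e \<subseteq> U"
    "\<forall>x\<in>cball p\<^sub>0 e. \<exists>v. frechet_derivative r (at x) v \<noteq> 0" and B: "0 < B"
    "\<And>p. p \<in> cball p\<^sub>0 e \<Longrightarrow> (cmod (hess_LN r p))\<^sup>2 \<le> B * (Re (hess_LL r p) + B * (r p)\<^sup>2)"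
    by (rule near_frontier_estimate[OF \<Omega> ldf LN \<nu>]) blast
  have U: "open U" "smooth_on U r" "p\<^sub>0 \<in> U" "p\<^sub>0 \<in> frontier \<Omega>"
    using ldf by (auto simp: local_defining_function_def)
  define S where "S = ball p\<^sub>0 e"
  have SU: "S \<subseteq> U" "p\<^sub>0 \<in> S" "S \<subseteq> cball p\<^sub>0 e" using e by (auto simp: S_def)
  have S: "open S" "smooth_on S r" "\<forall>x\<in>S. \<exists>v. frechet_derivative r (at x) v \<noteq> 0"
    using SU smooth_on_subset[OF U(2)] e(3) by (auto simp: S_def)
  have ldfS: "local_defining_function \<Omega> p\<^sub>0 S r"
    by (rule local_defining_function_subset[OF ldf S(1) SU(2,1)])
  define D where "D = cball p\<^sub>0 (e/2)"
  have D: "compact D" "D \<subseteq> S" "D \<noteq> {}" using e(1) by (auto simp: D_def S_def)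
  let ?NN = "\<lambda>p. complex_hessian r p (field_N r p) (field_N r p)"
  have "continuous_on D ?NN"
    using smooth_on_imp_continuous_on[OF hess_smooth(3)[OF S]] by (rule continuous_on_subset[OF _ D(2)])
  then have "bounded (?NN ` D)" using D(1) by (intro compact_imp_bounded compact_continuous_image)
  then obtain n where n: "0 < n" "\<And>x. x \<in> D \<Longrightarrow> cmod (?NN x) \<le> n"
    unfolding bounded_pos by blast
  \<comment> \<open>This is the square of \<open>N r\<close>. Its positive minimum
    \<open>\<sigma>0\<close> on the compact \<open>D\<close> measures the least gain in the
    direction \<open>N\<close>.\<close>
  define \<sigma> where "\<sigma> p = (cmod (dz 1 r p))\<^sup>2 + (cmod (dz 2 r p))\<^sup>2" for p
  have \<sigma>: "0 < \<sigma> x" if "x \<in> S" for x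
    using dz_nonzero_iff[OF smooth_on_has_derivative[OF S(2) that]] S(3) that by (simp add: \<sigma>_def)
  have "continuous_on S (dz j r)" for j
    by (rule smooth_on_imp_continuous_on[OF smooth_on_dz[OF S(1,2)]])
  then have "continuous_on D \<sigma>"
    unfolding \<sigma>_def[abs_def] using D(2) by (intro continuous_intros) (auto intro: continuous_on_subset)
  from continuous_attains_inf[OF D(1,3) this] obtain x0 where x0: "x0 \<in> D" "\<And>x. x \<in> D \<Longrightarrow> \<sigma> x0 \<le> \<sigma> x"
    by blast
  define \<sigma>0 where "\<sigma>0 = \<sigma> x0"
  have \<sigma>0: "0 < \<sigma>0" "\<And>x. x \<in> D \<Longrightarrow> \<sigma>0 \<le> \<sigma> x" using x0 \<sigma> D(2) by (auto simp: \<sigma>0_def)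
  \<comment> \<open>\<open>M\<close> is three times \<open>B\<close> so that half of the weight's
    Hessian pays for \<open>3/2 * B * r\<^sup>2\<close>. \<open>K\<close> is fixed by
    \<open>(K - 4 * M) * \<sigma>0 = B + n\<close>, the amount needed in the direction
    \<open>N\<close>.\<close>
  define M where "M = 3 * B"
  define K where "K = 4 * M + (B + n) / \<sigma>0"
  have M: "0 < M" and K: "0 < K" "4 * M \<le> K" using B(1) n(1) \<sigma>0(1) by (auto simp: M_def K_def add_pos_pos)
  define g where "g x = K + M * (norm (x - p\<^sub>0))\<^sup>2" for x
  define \<rho> where "\<rho> x = r x + (r x)\<^sup>2 * g x" for x
  have g: "smooth_on S g" "dz j g p = M * cnj (p $ j - p\<^sub>0 $ j)"
    "complex_hessian g p a a = of_real (M * (norm a)\<^sup>2)" for j p a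
    using quadratic_weight[where K = K and M = M and c = p\<^sub>0] S(1) unfolding g_def[abs_def] by auto
  have gK: "K \<le> g x" for x using M by (simp add: g_def)
  have r0: "r p\<^sub>0 = 0" by (rule local_defining_function_zero[OF \<Omega>(1) ldfS U(4) SU(2)])
  \<comment> \<open>The bound 1/4 makes \<open>1 + r x * g x\<close> positive, so
    \<open>\<rho>\<close> and \<open>r\<close> have the same sign, and puts
    \<open>1 + 2 * r x * g x\<close> between 1/2 and 3/2. Radius at most 1 bounds the derivative of
    the weight along \<open>a\<close> by \<open>M * norm a\<close>.\<close>
  define V where "V = ball p\<^sub>0 (min (e/2) 1) \<inter> {x \<in> S. \<bar>r x * g x\<bar> < 1/4}"
  have "continuous_on S (\<lambda>x. \<bar>r x * g x\<bar>)"
    using smooth_on_imp_continuous_on[OF S(2)] smooth_on_imp_continuous_on[OF g(1)]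
    by (intro continuous_intros)
  then have "open {x \<in> S. \<bar>r x * g x\<bar> < 1/4}"
    using continuous_open_preimage[OF _ S(1) open_lessThan[of "1/4 :: real"]]
    by (simp add: vimage_def Int_def)
  then have V: "open V" "p\<^sub>0 \<in> V" "V \<subseteq> S" "V \<subseteq> D" "\<And>x. x \<in> V \<Longrightarrow> norm (x - p\<^sub>0) \<le> 1"
    "\<And>x. x \<in> V \<Longrightarrow> \<bar>r x * g x\<bar> < 1/4"
    using e(1) SU(2) r0 by (auto simp: V_def D_def dist_norm norm_minus_commute)
  show thesis
  proof (rule that[of V \<rho>])
    show "local_defining_function \<Omega> p\<^sub>0 V \<rho>"
      unfolding local_defining_function_def
    proof (intro conjI ballI)
      have "smooth_on S \<rho>"
        unfolding \<rho>_def[abs_def] using S g(1) by (intro smooth_on_add smooth_on_mult smooth_on_power2)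
      then show "smooth_on V \<rho>" using V(3) by (rule smooth_on_subset)
      have "\<rho> x < 0 \<longleftrightarrow> r x < 0" if "x \<in> V" for x
      proof -
        have "\<rho> x = r x * (1 + r x * g x)" by (simp add: \<rho>_def algebra_simps power2_eq_square)
        moreover have "1 + r x * g x > 0" using V(6)[OF that] by linarith
        ultimately show ?thesis by (simp add: mult_less_0_iff)
      qed
      moreover have "\<Omega> \<inter> S = {x \<in> S. r x < 0}" using ldfS by (simp add: local_defining_function_def)
      ultimately show "\<Omega> \<inter> V = {p \<in> V. \<rho> p < 0}" using V(3) by blast
      fix p assume p: "p \<in> frontier \<Omega> \<inter> V"
      then have pS: "p \<in> S" using V(3) by blast
      have rp: "r p = 0" using local_defining_function_zero[OF \<Omega>(1) ldfS _ pS] p by blast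
      \<comment> \<open>Since \<open>r p = 0\<close>, the added term
        \<open>(r x)\<^sup>2 * g x\<close> has zero derivative at \<open>p\<close>.\<close>
      have "(\<rho> has_derivative frechet_derivative r (at p)) (at p)"
        unfolding \<rho>_def[abs_def]
        using smooth_on_has_derivative[OF S(2) pS] smooth_on_has_derivative[OF g(1) pS] rp
        by (auto intro!: derivative_eq_intros)
      then show "\<exists>v. frechet_derivative \<rho> (at p) v \<noteq> 0"
        using S(3) pS by (simp add: frechet_derivative_eqI)
    qed (use V U in auto)
    fix p a assume p: "p \<in> V"
    then have pS: "p \<in> S" "p \<in> D" "p \<in> cball p\<^sub>0 e" using V SU by auto
    obtain x y where xy: "a = x *s field_L r p + y *s field_N r p"
      "(cmod x)\<^sup>2 + (cmod y)\<^sup>2 = (norm a)\<^sup>2"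
      "dz 1 r p * a $ 1 + dz 2 r p * a $ 2 = y * of_real (sqrt (\<sigma> p))"
      using frame_decomposition[OF smooth_on_has_derivative[OF S(2) pS(1)] \<sigma>[OF pS(1), unfolded \<sigma>_def]]
      unfolding \<sigma>_def by blast
    define s where "s = sqrt (\<sigma> p)"
    have s: "0 < s" "s\<^sup>2 = \<sigma> p" using \<sigma>[OF pS(1)] by (auto simp: s_def)
    define \<beta> where "\<beta> = dz 1 g p * a $ 1 + dz 2 g p * a $ 2"
    have \<beta>: "cmod \<beta> \<le> M * norm a"
    proof -
      let ?q = "p - p\<^sub>0"
      have eq: "\<beta> = M * (cnj (?q $ 1) * a $ 1 + cnj (?q $ 2) * a $ 2)"
        by (simp add: \<beta>_def g(2) algebra_simps)
      have "cmod (cnj (?q $ 1) * a $ 1 + cnj (?q $ 2) * a $ 2)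
         \<le> cmod (?q $ 1) * cmod (a $ 1) + cmod (?q $ 2) * cmod (a $ 2)"
        by (rule norm_triangle_le) (simp only: norm_mult complex_mod_cnj)
      also have "\<dots> \<le> norm ?q * norm a"
        using L2_set_mult_ineq[of "\<lambda>i. cmod (?q $ i)" "\<lambda>i. cmod (a $ i)" UNIV]
        by (simp add: norm_vec_def sum_2)
      also have "\<dots> \<le> 1 * norm a" using V(5)[OF p] by (intro mult_right_mono) auto
      finally show ?thesis unfolding eq using M by (simp add: norm_mult)
    qed
    let ?w = "cmod (hess_LN r p)" and ?f = "Re (hess_LL r p)" and ?u = "1 + 2 * r p * g p"
    have Hr: "Re (complex_hessian r p a a) \<ge> (cmod x)\<^sup>2 * ?f - 2 * cmod x * cmod y * ?w - n * (cmod y)\<^sup>2"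
    proof -
      have "Re (complex_hessian r p a a) = (cmod x)\<^sup>2 * ?f + 2 * Re (x * cnj y * hess_LN r p)
         + (cmod y)\<^sup>2 * Re (?NN p)"
        unfolding xy(1) hess_LL_def hess_LN_def by (rule complex_hessian_combination[OF S(1,2) pS(1)])
      moreover have "\<bar>Re (x * cnj y * hess_LN r p)\<bar> \<le> cmod x * cmod y * ?w"
        using abs_Re_le_cmod[of "x * cnj y * hess_LN r p"] by (simp add: norm_mult)
      moreover have "- n \<le> Re (?NN p)" using n(2)[OF pS(2)] abs_Re_le_cmod[of "?NN p"] by linarith
      then have "(cmod y)\<^sup>2 * (- n) \<le> (cmod y)\<^sup>2 * Re (?NN p)" by (rule mult_left_mono) simp
      ultimately show ?thesis by (simp add: algebra_simps)
    qed
    have u: "0 \<le> ?u" "?u \<le> 3/2" using V(6)[OF p] by linarith+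
    \<comment> \<open>By \<open>L r = 0\<close> the derivative of \<open>r\<close> along
      \<open>a\<close> has modulus \<open>cmod y * s\<close>, so the gain from \<open>K\<close>
      falls on the \<open>N\<close> component alone, while
      \<open>(r p)\<^sup>2 * (M * (norm a)\<^sup>2)\<close> covers both components.\<close>
    have "?u * ((cmod x)\<^sup>2 * ?f - 2 * cmod x * cmod y * ?w - n * (cmod y)\<^sup>2) + 2 * K * (cmod y * s)\<^sup>2
        - 4 * \<bar>r p\<bar> * cmod \<beta> * (cmod y * s) + (r p)\<^sup>2 * (M * (norm a)\<^sup>2)
        \<le> Re (complex_hessian \<rho> p a a)"
    proof -
      have nys: "cmod (y * of_real s) = cmod y * s" using s(1) by (simp add: norm_mult)
      have "Re (complex_hessian \<rho> p a a) = ?u * Re (complex_hessian r p a a)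
         + 2 * g p * (cmod y * s)\<^sup>2 + 4 * r p * Re (\<beta> * cnj (y * of_real s))
         + (r p)\<^sup>2 * (M * (norm a)\<^sup>2)"
        unfolding \<rho>_def[abs_def] complex_hessian_perturbation[OF S(1) pS(1) S(2) g(1)] xy(3)
        unfolding nys[unfolded s_def] by (simp only: s_def \<beta>_def g(3) Re_complex_of_real)
      moreover have "?u * ((cmod x)\<^sup>2 * ?f - 2 * cmod x * cmod y * ?w - n * (cmod y)\<^sup>2)
          \<le> ?u * Re (complex_hessian r p a a)"
        by (rule mult_left_mono[OF Hr u(1)])
      moreover have "2 * K * (cmod y * s)\<^sup>2 \<le> 2 * g p * (cmod y * s)\<^sup>2"
        using gK[of p] by (intro mult_right_mono) auto
      moreover have "\<bar>4 * r p * Re (\<beta> * cnj (y * of_real s))\<bar> \<le> 4 * \<bar>r p\<bar> * cmod \<beta> * (cmod y * s)"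
      proof -
        have "\<bar>Re (\<beta> * cnj (y * of_real s))\<bar> \<le> cmod \<beta> * (cmod y * s)"
          using abs_Re_le_cmod[of "\<beta> * cnj (y * of_real s)"] s(1) by (simp add: norm_mult)
        then have "4 * \<bar>r p\<bar> * \<bar>Re (\<beta> * cnj (y * of_real s))\<bar> \<le> 4 * \<bar>r p\<bar> * (cmod \<beta> * (cmod y * s))"
          by (rule mult_left_mono) simp
        then show ?thesis unfolding abs_mult by (simp only: abs_numeral mult.assoc)
      qed
      ultimately show ?thesis by (smt (verit))
    qed
    then show "0 \<le> Re (complex_hessian \<rho> p a a)"
    proof (rule perturbation_estimate[OF _ B(2)[OF pS(3)] B(1) u _ _ _ _ _ _ \<beta> M_def])
      have "B + n = (K - 4 * M) * \<sigma>0" using \<sigma>0(1) by (simp add: K_def)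
      also have "\<dots> \<le> (K - 4 * M) * s\<^sup>2"
        using \<sigma>0(2)[OF pS(2)] K(2) s(2) by (intro mult_left_mono) auto
      finally show "B + n \<le> (K - 4 * M) * s\<^sup>2" .
    qed (use xy n s in auto)
  qed
qed

theorem proposition6p8:
  fixes \<Omega> :: "(complex ^ 2) set" and p\<^sub>0 :: "complex ^ 2"
  assumes "open \<Omega>" "connected \<Omega>" "\<Omega> \<noteq> {}"
    and "smooth_boundary \<Omega>"
    and "pseudoconvex \<Omega>"
    and "p\<^sub>0 \<in> frontier \<Omega>"
  shows "(\<exists>U r. local_defining_function \<Omega> p\<^sub>0 U r \<and> psh_near U r p\<^sub>0) \<longleftrightarrow>
         (\<exists>U r. local_defining_function \<Omega> p\<^sub>0 U r \<and>
            bigo_on (frontier \<Omega> \<inter> U) (\<lambda>p. (cmod (hess_LN r p))\<^sup>2) (hess_LL r) \<and>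
            bigo_on (frontier \<Omega> \<inter> U) (\<lambda>p. (cmod (normal_deriv_hess_LL r p))\<^sup>2) (hess_LL r))"
proof (intro iffI; elim exE conjE)
  fix U r
  assume ldf: "local_defining_function \<Omega> p\<^sub>0 U r" and "psh_near U r p\<^sub>0"
  then obtain V where V: "open V" "p\<^sub>0 \<in> V" "V \<subseteq> U" "\<And>p a. p \<in> V \<Longrightarrow> 0 \<le> Re (complex_hessian r p a a)"
    by (auto simp: psh_near_def)
  \<comment> \<open>The estimates concern all boundary points of the neighborhood, so it is shrunk
    to \<open>V\<close>, where the Hessian is positive semidefinite throughout.\<close>
  have "local_defining_function \<Omega> p\<^sub>0 V r" by (rule local_defining_function_subset[OF ldf V(1-3)])
  with psh_imp_bigo[OF this V(4)] show "\<exists>U r. local_defining_function \<Omega> p\<^sub>0 U r \<and>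
            bigo_on (frontier \<Omega> \<inter> U) (\<lambda>p. (cmod (hess_LN r p))\<^sup>2) (hess_LL r) \<and>
            bigo_on (frontier \<Omega> \<inter> U) (\<lambda>p. (cmod (normal_deriv_hess_LL r p))\<^sup>2) (hess_LL r)"
    by blast
next
  fix U r
  assume "local_defining_function \<Omega> p\<^sub>0 U r"
    "bigo_on (frontier \<Omega> \<inter> U) (\<lambda>p. (cmod (hess_LN r p))\<^sup>2) (hess_LL r)"
    "bigo_on (frontier \<Omega> \<inter> U) (\<lambda>p. (cmod (normal_deriv_hess_LL r p))\<^sup>2) (hess_LL r)"
  from bigo_imp_psh[OF assms(1,5) this] obtain V \<rho> where
    V: "local_defining_function \<Omega> p\<^sub>0 V \<rho>" "\<And>p a. p \<in> V \<Longrightarrow> 0 \<le> Re (complex_hessian \<rho> p a a)"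
    by blast
  then have "psh_near V \<rho> p\<^sub>0"
    unfolding psh_near_def local_defining_function_def by (intro exI[of _ V]) auto
  with V(1) show "\<exists>U r. local_defining_function \<Omega> p\<^sub>0 U r \<and> psh_near U r p\<^sub>0" by blast
qed

end
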